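(* For every real number $c$ with $0<c<1$ there exists a profinite group $G$ such that $G$ contains a closed normal subgroup isomorphic to a cartesian product of infinitely many copies of the alternating group $A_6$, $G$ is not virtually prosolvable, and $P_2(G)\geq c$.
   Context: For a profinite group $G$, an element $g\in G$ is a $2$-element if $\langle g\rangle N/N$ is a finite $2$-group for every open normal subgroup $N$ of $G$. $\Omega_2(G)$ denotes the set of $2$-elements of $G$, which is closed, and $P_2(G)=\mu(\Omega_2(G))$, where $\mu$ is the normalized Haar measure on $G$. A profinite group is virtually prosolvable if it contains an open prosolvable subgroup. *)

theory Defs
  imports
    "HOL-Analysis.Analysis"
    "HOL-Algebra.Product_Groups"
    "HOL-Algebra.Sym_Groups"
begin

text \<open>A topological group is an HOL-Algebra group together with an abstract topology whose
  underlying space is the carrier.\<close>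

definition topological_group :: "('a, 'm) monoid_scheme \<Rightarrow> 'a topology \<Rightarrow> bool" where
  "topological_group G T \<longleftrightarrow>
     group G \<and> topspace T = carrier G \<and>
     continuous_map (prod_topology T T) T (\<lambda>(x, y). x \<otimes>\<^bsub>G\<^esub> y) \<and>
     continuous_map T T (\<lambda>x. inv\<^bsub>G\<^esub> x)"

definition totally_disconnected_space :: "'a topology \<Rightarrow> bool" where
  "totally_disconnected_space T \<longleftrightarrow> (\<forall>S. connectedin T S \<longrightarrow> (\<exists>x. S \<subseteq> {x}))"

definition profinite_group :: "('a, 'm) monoid_scheme \<Rightarrow> 'a topology \<Rightarrow> bool" where
  "profinite_group G T \<longleftrightarrow>
     topological_group G T \<and> compact_space T \<and> Hausdorff_space T \<and> totally_disconnected_space T"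

definition prosolvable_group :: "('a, 'm) monoid_scheme \<Rightarrow> 'a topology \<Rightarrow> bool" where
  "prosolvable_group G T \<longleftrightarrow>
     profinite_group G T \<and> (\<forall>N. N \<lhd> G \<and> openin T N \<longrightarrow> solvable (G Mod N))"

definition virtually_prosolvable_group :: "('a, 'm) monoid_scheme \<Rightarrow> 'a topology \<Rightarrow> bool" where
  "virtually_prosolvable_group G T \<longleftrightarrow>
     profinite_group G T \<and>
     (\<exists>H. subgroup H G \<and> openin T H \<and>
          prosolvable_group (G\<lparr>carrier := H\<rparr>) (subtopology T H))"

definition topologically_isomorphic ::
    "('a, 'm) monoid_scheme \<Rightarrow> 'a topology \<Rightarrow> ('b, 'n) monoid_scheme \<Rightarrow> 'b topology \<Rightarrow> bool" where
  "topologically_isomorphic G S H T \<longleftrightarrow> (\<exists>f. f \<in> iso G H \<and> homeomorphic_map S T f)"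

definition finite_p_group :: "nat \<Rightarrow> ('a, 'm) monoid_scheme \<Rightarrow> bool" where
  "finite_p_group p G \<longleftrightarrow> group G \<and> finite (carrier G) \<and> (\<exists>k. card (carrier G) = p ^ k)"

text \<open>The set \<open>\<Omega>\<^sub>p(G)\<close> of \<open>p\<close>-elements.  Here \<open>\<langle>g\<rangle>\<close> is the abstract cyclic subgroup; as \<open>N\<close> is
  open, replacing it by its closure would not change \<open>\<langle>g\<rangle>N\<close>.\<close>

definition p_elements :: "nat \<Rightarrow> ('a, 'm) monoid_scheme \<Rightarrow> 'a topology \<Rightarrow> 'a set" where
  "p_elements p G T =
     {g \<in> carrier G. \<forall>N. N \<lhd> G \<and> openin T N \<longrightarrow>
        finite_p_group p (G\<lparr>carrier := generate G {g} <#>\<^bsub>G\<^esub> N\<rparr> Mod N)}"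

text \<open>Outer regularity is part of the definition because, without second countability,
  invariance alone need not determine a Borel measure.  On a compact space with a finite measure
  it also yields inner regularity by closed sets, by taking complements.\<close>

definition normalized_haar_measure ::
    "('a, 'm) monoid_scheme \<Rightarrow> 'a topology \<Rightarrow> 'a measure \<Rightarrow> bool" where
  "normalized_haar_measure G T \<mu> \<longleftrightarrow>
     space \<mu> = carrier G \<and>
     sets \<mu> = sigma_sets (carrier G) {U. openin T U} \<and>
     emeasure \<mu> (carrier G) = 1 \<and>
     (\<forall>g \<in> carrier G. \<forall>A \<in> sets \<mu>. emeasure \<mu> (g <#\<^bsub>G\<^esub> A) = emeasure \<mu> A) \<and>
     (\<forall>A \<in> sets \<mu>. emeasure \<mu> A = (INF U \<in> {U. openin T U \<and> A \<subseteq> U}. emeasure \<mu> U))"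

text \<open>\<open>P\<^sub>p(G)\<close>; the argument \<open>\<mu>\<close> is meant to be the normalized Haar measure.\<close>

definition prob_p_elements ::
    "nat \<Rightarrow> ('a, 'm) monoid_scheme \<Rightarrow> 'a topology \<Rightarrow> 'a measure \<Rightarrow> real" where
  "prob_p_elements p G T \<mu> = measure \<mu> (p_elements p G T)"

end

theory Submission
  imports
    Defs
    "HOL-Probability.Infinite_Product_Measure"
    "HOL-Algebra.SndIsomorphismGrp"
    "HOL-Algebra.Multiplicative_Group"
begin

text \<open>
  The Mathieu group \<open>M\<^sub>1\<^sub>0\<close> contains \<open>A\<^sub>6\<close> with index 2, and every element of \<open>M\<^sub>1\<^sub>0\<close> outside \<open>A\<^sub>6\<close> has order 4
  or 8.  The pullback of infinitely many copies of \<open>M\<^sub>1\<^sub>0\<close> over the quotient of order 2 therefore has \<open>P\<^sub>2\<close> at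
  least \<open>1/2\<close>.  To come close to 1, the quotient of order 2 is replaced by a cyclic group \<open>\<int>/2m\<close> with
  \<open>m = 2\<^sup>s\<close>.  A generator permutes the copies of \<open>A\<^sub>6\<close> in cycles of length \<open>m\<close>, and its \<open>m\<close>-th power acts on
  every copy like an element of \<open>M\<^sub>1\<^sub>0 - A\<^sub>6\<close>.  Since \<open>\<int>/2m\<close> is a cyclic 2-group, every nonzero element has a
  2-power multiple equal to its unique involution \<open>m\<close>.  So every element of the extension outside \<open>A\<^sub>6\<^sup>\<nat>\<close> has a
  2-power that lies, coordinate by coordinate, in \<open>M\<^sub>1\<^sub>0 - A\<^sub>6\<close>, and is a 2-element
  (\<open>nontrivial_coset_2_power_order\<close>).  These elements have measure \<open>1 - 1/2m\<close>.  The closed normal subgroup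
  \<open>A\<^sub>6\<^sup>\<nat>\<close> prevents the group from being virtually prosolvable, as every open subgroup contains almost all of
  the copies of \<open>A\<^sub>6\<close>.

  Existence of \<open>M\<^sub>1\<^sub>0\<close> with the stated element orders is the arithmetic input.  With an outer automorphism
  \<open>\<theta>\<close> of \<open>S\<^sub>6\<close> of order 2, the elements of \<open>M\<^sub>1\<^sub>0 - A\<^sub>6\<close> are the products \<open>p \<theta>\<close> with \<open>p\<close> odd, so that the claim on
  orders becomes \<open>(p \<theta>(p))\<^sup>4 = 1\<close> for all odd \<open>p\<close>; this is a finite check (\<open>odd_outer_order4\<close>).  The
  automorphism comes from Sylvester's duality between duads and synthemes.  All that is retained for the
  extension is the automorphism \<open>\<tau>\<close> of \<open>A\<^sub>6\<close> induced by one element of \<open>M\<^sub>1\<^sub>0 - A\<^sub>6\<close>, together with the square \<open>u\<close>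
  of that element (\<open>alt_group_6_twist\<close>).

  The topology and the Haar measure are handled for any group whose carrier is a product of finite sets and
  whose multiplication is compatible with truncating sequences (locale \<open>coordinate_group\<close>); there the product
  of the uniform measures is invariant because translations permute the cylinder sets of a given length.
\<close>

section \<open>An outer involution of the symmetric group on six letters\<close>

text \<open>Values at the point \<open>1\<close> are looked up by rewriting, so the numeral has to stay in this form.\<close>

declare One_nat_def [simp del]

abbreviation swp :: "nat \<Rightarrow> nat \<Rightarrow> nat \<Rightarrow> nat" where "swp \<equiv> Transposition.transpose"

text \<open>
  The six total partitions of the fifteen duads \<open>{a, b}\<close> of \<open>{1, \<dots>, 6}\<close> into synthemes can be labelled
  by \<open>1, \<dots>, 6\<close>, and any two of them share exactly one syntheme.  The table lists the syntheme shared by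
  the totals labelled \<open>a\<close> and \<open>b\<close>.  The labelling is one of the 36 for which the relation
  ``the duad \<open>{i, j}\<close> occurs in the syntheme of \<open>{a, b}\<close>'' is symmetric; this symmetry is what makes the
  resulting outer automorphism an involution.
\<close>

definition synthemes :: "((nat \<times> nat) \<times> (nat \<times> nat) list) list" where
  "synthemes =
    [((1,2), [(1,2), (3,4), (5,6)]), ((1,3), [(1,3), (2,5), (4,6)]), ((1,4), [(1,4), (2,6), (3,5)]),
     ((1,5), [(1,5), (2,4), (3,6)]), ((1,6), [(1,6), (2,3), (4,5)]), ((2,3), [(1,6), (2,4), (3,5)]),
     ((2,4), [(1,5), (2,3), (4,6)]), ((2,5), [(1,3), (2,6), (4,5)]), ((2,6), [(1,4), (2,5), (3,6)]),
     ((3,4), [(1,2), (3,6), (4,5)]), ((3,5), [(1,4), (2,3), (5,6)]), ((3,6), [(1,5), (2,6), (3,4)]),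
     ((4,5), [(1,6), (2,5), (3,4)]), ((4,6), [(1,3), (2,4), (5,6)]), ((5,6), [(1,2), (3,5), (4,6)])]"

definition swaps :: "(nat \<times> nat) list \<Rightarrow> nat \<Rightarrow> nat" where
  "swaps s = foldr (\<lambda>(i, j) f. swp i j \<circ> f) s id"

text \<open>
  Finite checks are carried out on lists of values: \<open>vals\<close> tabulates a permutation of \<open>{1, \<dots>, 6}\<close> and
  \<open>app\<close> reads such a table.
\<close>

definition vals :: "(nat \<Rightarrow> nat) \<Rightarrow> nat list" where
  "vals f = map f [1,2,3,4,5,6]"

definition dual_table :: "((nat \<times> nat) \<times> nat list) list" where
  "dual_table = map (\<lambda>(d, s). (d, vals (swaps s))) synthemes"

lemma dual_table_code [code]:
  "dual_table =
    [((1,2), [2,1,4,3,6,5]), ((1,3), [3,5,1,6,2,4]), ((1,4), [4,6,5,1,3,2]),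
     ((1,5), [5,4,6,2,1,3]), ((1,6), [6,3,2,5,4,1]), ((2,3), [6,4,5,2,3,1]),
     ((2,4), [5,3,2,6,1,4]), ((2,5), [3,6,1,5,4,2]), ((2,6), [4,5,6,1,2,3]),
     ((3,4), [2,1,6,5,4,3]), ((3,5), [4,3,2,1,6,5]), ((3,6), [5,6,4,3,1,2]),
     ((4,5), [6,5,4,3,2,1]), ((4,6), [3,4,1,2,6,5]), ((5,6), [2,1,5,6,3,4])]"
  by (simp add: dual_table_def synthemes_def vals_def swaps_def transpose_def)

fun app :: "nat list \<Rightarrow> nat \<Rightarrow> nat" where
  "app [a,b,c,d,e,f] x = (if x = 1 then a else if x = 2 then b else if x = 3 then c
     else if x = 4 then d else if x = 5 then e else if x = 6 then f else x)"
| "app _ x = x"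

definition dual_list :: "nat \<Rightarrow> nat \<Rightarrow> nat list" where
  "dual_list a b = (case map_of dual_table (if a < b then (a, b) else (b, a)) of
     None \<Rightarrow> [1,2,3,4,5,6] | Some s \<Rightarrow> s)"

text \<open>The triple transposition belonging to \<open>{a, b}\<close>; it will be the image of \<open>(a b)\<close>.\<close>

definition dual :: "nat \<Rightarrow> nat \<Rightarrow> nat \<Rightarrow> nat" where
  "dual a b = app (dual_list a b)"

text \<open>
  The tabulated form of the relation \<open>intertwines\<close> below.  Checking it for the fifteen transpositions and
  their duals, in both orders, shows that the automorphism exists on all of \<open>S\<^sub>6\<close> and is its own inverse,
  since these transpositions generate \<open>S\<^sub>6\<close>.
\<close>

definition compatible_lists :: "nat list \<Rightarrow> nat list \<Rightarrow> bool" where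
  "compatible_lists P Q \<longleftrightarrow> (\<forall>((a, b), R) \<in> set dual_table.
     map (app Q) R = map (app (dual_list (app P a) (app P b))) Q)"

lemma compatible_lists_dual:
  "\<forall>((c, d), Q) \<in> set dual_table.
     compatible_lists (vals (swp c d)) Q \<and> compatible_lists Q (vals (swp c d))"
  by code_simp

fun square_list :: "nat list \<Rightarrow> nat list" where
  "square_list W = map (app W) W"

text \<open>
  Every permutation of \<open>{1, \<dots>, n}\<close> is uniquely \<open>(n b) \<circ> r\<close> with \<open>b \<le> n\<close> and \<open>r\<close> a permutation of
  \<open>{1, \<dots>, n - 1}\<close>.  The recursion runs through the tree of these choices; each pair in the first argument
  holds a value of \<open>n\<close> and the \<open>b < n\<close> still to be tried there.  The other arguments carry a permutation
  \<open>p\<close>, its image under the outer automorphism, and whether \<open>p\<close> is odd.  At an odd leaf the product of the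
  two must have order dividing 4.  The recursion is kept first order, without a bounded quantifier over
  \<open>b\<close>, because rewriting under a binder would unroll the whole tree symbolically.
\<close>

function all_odd_order4 :: "(nat \<times> nat list) list \<Rightarrow> nat list \<Rightarrow> nat list \<Rightarrow> bool \<Rightarrow> bool" where
  "all_odd_order4 [] P Q s \<longleftrightarrow>
     (s \<longrightarrow> square_list (square_list (map (app P) Q)) = [1,2,3,4,5,6])"
| "all_odd_order4 ((i, []) # ps) P Q s \<longleftrightarrow> all_odd_order4 ps P Q s"
| "all_odd_order4 ((i, a # as) # ps) P Q s \<longleftrightarrow>
     all_odd_order4 ps (map (swp i a) P) (map (app (dual_list i a)) Q) (\<not> s) \<and>
     all_odd_order4 ((i, as) # ps) P Q s"
  by pat_completeness auto
termination
  by (relation "Wellfounded.measure (\<lambda>(ps, _). \<Sum>(i, as)\<leftarrow>ps. Suc (length as))") auto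

(* Otherwise every later simp call would try to run the whole enumeration. *)
declare all_odd_order4.simps [simp del]

lemma all_odd_order4_id:
  "all_odd_order4 [(2,[1]),(3,[1,2]),(4,[1,2,3]),(5,[1,2,3,4]),(6,[1,2,3,4,5])]
     [1,2,3,4,5,6] [1,2,3,4,5,6] False"
  by code_simp

lemma all_odd_order4_branch:
  "all_odd_order4 ((i, as) # ps) P Q s \<longleftrightarrow> all_odd_order4 ps P Q s \<and>
     (\<forall>a\<in>set as. all_odd_order4 ps (map (swp i a) P) (map (app (dual_list i a)) Q) (\<not> s))"
  by (induction as) (auto simp: all_odd_order4.simps)

text \<open>
  The graph of the outer automorphism, described by the structure that \<open>q\<close> and \<open>p\<close> have to preserve.  In
  this form closure under composition is immediate, which a table of images would not give.
\<close>

definition intertwines :: "(nat \<Rightarrow> nat) \<Rightarrow> (nat \<Rightarrow> nat) \<Rightarrow> bool" where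
  "intertwines p q \<longleftrightarrow> p permutes {1..6} \<and> q permutes {1..6} \<and>
     (\<forall>a\<in>{1..6}. \<forall>b\<in>{1..6}. a \<noteq> b \<longrightarrow> q \<circ> dual a b = dual (p a) (p b) \<circ> q)"

lemma atLeast1AtMost6: "{1..6::nat} = {1,2,3,4,5,6}"
  by auto

lemma permutes6_permutation: "p permutes {1..6::nat} \<Longrightarrow> permutation p"
  unfolding permutation_permutes by (rule exI[of _ "{1..6}"]) simp

lemma app_vals:
  assumes "f permutes {1..6}"
  shows "app (vals f) = f"
proof
  fix x show "app (vals f) x = f x"
    using permutes_not_in[OF assms, of x] by (auto simp: vals_def)
qed

lemma map_app_vals: 
  assumes "p permutes {1..6}" "q permutes {1..6}"
  shows "map (app (vals p)) (vals q) = vals (p \<circ> q)"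
  by (simp add: app_vals[OF assms(1)]) (simp add: vals_def)

lemma dual_list_in_table:
  assumes "a \<in> {1..6}" "b \<in> {1..6}" "a < b"
  shows "((a, b), dual_list a b) \<in> set dual_table"
proof -
  have "\<forall>a\<in>set [1,2,3,4,5,6]. \<forall>b\<in>set [1,2,3,4,5,6]. a < b \<longrightarrow> ((a, b), dual_list a b) \<in> set dual_table"
    by code_simp
  moreover have "a \<in> set [1,2,3,4,5,6]" "b \<in> set [1,2,3,4,5,6]"
    using assms(1,2) by auto
  ultimately show ?thesis
    using assms(3) by blast
qed

lemma dual_commute: "dual a b = dual b a"
  by (cases a b rule: linorder_cases) (auto simp: dual_def dual_list_def)

lemma synthemes_wf:
  assumes "(d, s) \<in> set synthemes"
  shows "swaps s permutes {1..6}" and "sign (swaps s) = -1"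
proof -
  have "\<forall>(d, s) \<in> set synthemes. length s = 3 \<and> (\<forall>(i, j) \<in> set s. i \<noteq> j \<and> 1 \<le> i \<and> i \<le> 6 \<and> 1 \<le> j \<and> j \<le> 6)"
    by code_simp
  with assms have l: "length s = 3" and s: "\<And>i j. (i, j) \<in> set s \<Longrightarrow> i \<noteq> j \<and> i \<in> {1..6} \<and> j \<in> {1..6}"
    by auto
  have "swaps s permutes {1..6} \<and> sign (swaps s) = (-1) ^ length s"
    using s
  proof (induction s)
    case Nil
    then show ?case using permutes_id by (simp add: swaps_def id_def)
  next
    case (Cons ij s)
    obtain i j where ij: "ij = (i, j)" by (cases ij)
    have e: "swaps (ij # s) = swp i j \<circ> swaps s" by (simp add: swaps_def ij)
    have "swaps s permutes {1..6}" "sign (swaps s) = (-1) ^ length s"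
      using Cons by auto
    moreover have "i \<noteq> j" "swp i j permutes {1..6}"
      using Cons.prems[of i j] ij by (auto intro: permutes_swap_id)
    ultimately show ?case
      unfolding e using permutes_compose sign_compose sign_swap_id
      by (metis (no_types, lifting) finite_atLeastAtMost length_Cons permutation_permutes power_Suc)
  qed
  then show "swaps s permutes {1..6}" "sign (swaps s) = -1"
    using l by auto
qed

lemma dual_eq_swaps:
  assumes "a \<in> {1..6}" "b \<in> {1..6}" "a \<noteq> b"
  obtains d s where "(d, s) \<in> set synthemes" and "dual a b = swaps s"
    and "dual_list a b = vals (swaps s)"
proof -
  have *: "\<exists>s. ((a, b), s) \<in> set synthemes \<and> dual_list a b = vals (swaps s)"
    if "a \<in> {1..6}" "b \<in> {1..6}" "a < b" for a b
    using dual_list_in_table[OF that] by (auto simp: dual_table_def)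
  have "\<exists>d s. (d, s) \<in> set synthemes \<and> dual_list a b = vals (swaps s)"
  proof (cases "a < b")
    case False
    then have "b < a" using assms by simp
    moreover from this have "dual_list a b = dual_list b a"
      by (simp add: dual_list_def)
    ultimately show ?thesis
      using * assms by metis
  qed (use * assms in blast)
  then show thesis
    using that app_vals[OF synthemes_wf(1)] unfolding dual_def by metis
qed

lemma dual_permutes:
  assumes "a \<in> {1..6}" "b \<in> {1..6}" "a \<noteq> b"
  shows "dual a b permutes {1..6}" "sign (dual a b) = -1" "dual_list a b = vals (dual a b)"
  using dual_eq_swaps[OF assms] synthemes_wf by metis+

lemma compatible_lists_imp_intertwines:
  assumes pq: "p permutes {1..6}" "q permutes {1..6}" and c: "compatible_lists (vals p) (vals q)"
  shows "intertwines p q"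
proof -
  have *: "q \<circ> dual a b = dual (p a) (p b) \<circ> q" if ab: "a \<in> {1..6}" "b \<in> {1..6}" "a < b" for a b
  proof -
    have "map (app (vals q)) (dual_list a b) = map (app (dual_list (p a) (p b))) (vals q)"
      using c dual_list_in_table[OF ab] app_vals[OF pq(1)] by (fastforce simp: compatible_lists_def)
    moreover have pab: "p a \<in> {1..6}" "p b \<in> {1..6}" "p a \<noteq> p b"
      using ab permutes_in_image[OF pq(1)] inj_eq[OF permutes_inj[OF pq(1)]] by auto
    moreover have D: "dual a b permutes {1..6}" "dual (p a) (p b) permutes {1..6}"
      "dual_list a b = vals (dual a b)" "dual_list (p a) (p b) = vals (dual (p a) (p b))"
      using ab pab by (simp_all add: dual_permutes)
    ultimately have "vals (q \<circ> dual a b) = vals (dual (p a) (p b) \<circ> q)"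
      using map_app_vals[OF pq(2) D(1)] map_app_vals[OF D(2) pq(2)] by simp
    then have "app (vals (q \<circ> dual a b)) = app (vals (dual (p a) (p b) \<circ> q))"
      by (rule arg_cong)
    then show ?thesis
      by (simp only: app_vals[OF permutes_compose[OF D(1) pq(2)]] app_vals[OF permutes_compose[OF pq(2) D(2)]])
  qed
  have "q \<circ> dual a b = dual (p a) (p b) \<circ> q" if "a \<in> {1..6}" "b \<in> {1..6}" "a \<noteq> b" for a b
  proof (cases "a < b")
    case False
    then have "q \<circ> dual b a = dual (p b) (p a) \<circ> q" using * that by simp
    then show ?thesis by (simp only: dual_commute[of a b] dual_commute[of "p a" "p b"])
  next
    case True
    then show ?thesis by (rule *[OF that(1,2)])
  qed
  then show ?thesis
    using pq by (simp add: intertwines_def)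
qed

lemma intertwines_swap:
  assumes "c \<in> {1..6}" "d \<in> {1..6}" "c \<noteq> d"
  shows "intertwines (swp c d) (dual c d)" "intertwines (dual c d) (swp c d)"
proof -
  have *: "intertwines (swp c d) (dual c d) \<and> intertwines (dual c d) (swp c d)"
    if cd: "c \<in> {1..6}" "d \<in> {1..6}" "c < d" for c d
  proof -
    have "compatible_lists (vals (swp c d)) (dual_list c d)" "compatible_lists (dual_list c d) (vals (swp c d))"
      using compatible_lists_dual dual_list_in_table[OF cd] by fastforce+
    then show ?thesis
      using cd by (auto simp: dual_permutes intro!: compatible_lists_imp_intertwines permutes_swap_id)
  qed
  have **: "intertwines (swp c d) (dual c d) \<and> intertwines (dual c d) (swp c d)"
  proof (cases "c < d")
    case True
    then show ?thesis by (rule *[OF assms(1,2)])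
  next
    case False
    then have "d < c" using assms(3) by simp
    from *[OF assms(2,1) this] show ?thesis
      by (simp only: dual_commute[of c d] transpose_commute[of c d])
  qed
  show "intertwines (swp c d) (dual c d)" "intertwines (dual c d) (swp c d)"
    using **  by blast+
qed

lemma intertwines_comp:
  assumes "intertwines p q" "intertwines p' q'"
  shows "intertwines (p \<circ> p') (q \<circ> q')"
  unfolding intertwines_def
proof (intro conjI ballI impI)
  show "p \<circ> p' permutes {1..6}" "q \<circ> q' permutes {1..6}"
    using assms by (auto simp: intertwines_def intro: permutes_compose)
  fix a b :: nat
  assume ab: "a \<in> {1..6}" "b \<in> {1..6}" "a \<noteq> b"
  have p': "p' permutes {1..6}" using assms by (simp add: intertwines_def)
  have "p' a \<in> {1..6}" "p' b \<in> {1..6}" "p' a \<noteq> p' b"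
    using ab permutes_in_image[OF p'] inj_eq[OF permutes_inj[OF p']] by auto
  then have "q \<circ> dual (p' a) (p' b) = dual (p (p' a)) (p (p' b)) \<circ> q"
    using assms(1) by (simp add: intertwines_def)
  moreover have "q' \<circ> dual a b = dual (p' a) (p' b) \<circ> q'"
    using assms(2) ab by (simp add: intertwines_def)
  ultimately show "q \<circ> q' \<circ> dual a b = dual ((p \<circ> p') a) ((p \<circ> p') b) \<circ> (q \<circ> q')"
    by (metis comp_apply comp_assoc)
qed

lemma intertwines_id: "intertwines id id"
  by (simp add: intertwines_def permutes_id)

text \<open>
  This makes the relation single-valued.  A permutation that commutes with all duals is determined by the
  image of 1, because \<open>dual 1 k\<close> moves 1 to \<open>k\<close>.  The image of 1 itself is pinned down since
  \<open>dual 1 6\<close> and \<open>dual 2 3\<close> agree exactly on \<open>{1, 6}\<close>, while \<open>dual 1 3\<close> and \<open>dual 2 5\<close> agree exactly on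
  \<open>{1, 3}\<close>.
\<close>

lemma commuting_with_dual:
  assumes r: "r permutes {1..6}"
    and comm: "\<And>a b. a \<in> {1..6} \<Longrightarrow> b \<in> {1..6} \<Longrightarrow> a \<noteq> b \<Longrightarrow> r \<circ> dual a b = dual a b \<circ> r"
  shows "r = id"
proof -
  have c: "r (dual a b x) = dual a b (r x)" if "a \<in> {1..6}" "b \<in> {1..6}" "a \<noteq> b" for a b x
    using comm[OF that] by (metis comp_apply)
  have r1: "r 1 \<in> {1..6}"
    using permutes_in_image[OF r, of 1] by simp
  have k: "dual 1 2 1 = 2" "dual 1 3 1 = 3" "dual 1 4 1 = 4" "dual 1 5 1 = 5" "dual 1 6 1 = 6"
    "dual 2 3 1 = 6" "dual 2 5 1 = 3"
    by (simp_all add: dual_def dual_list_def dual_table_code)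
  have "dual 1 6 (r 1) = dual 2 3 (r 1)" "dual 1 3 (r 1) = dual 2 5 (r 1)"
    using c[of 1 6 1] c[of 2 3 1] c[of 1 3 1] c[of 2 5 1] by (auto simp: k)
  then have 1: "r 1 = 1"
    using r1 by (auto simp: atLeast1AtMost6 dual_def dual_list_def dual_table_code)
  have "r 2 = 2" "r 3 = 3" "r 4 = 4" "r 5 = 5" "r 6 = 6"
    using c[of 1 2 1] c[of 1 3 1] c[of 1 4 1] c[of 1 5 1] c[of 1 6 1] by (simp_all add: k 1)
  with 1 have "r x = x" if "x \<in> {1..6}" for x
    using that by (auto simp: atLeast1AtMost6)
  then show ?thesis
    using permutes_not_in[OF r] by fastforce
qed

lemma intertwines_unique:
  assumes "intertwines p q" "intertwines p q'"
  shows "q = q'"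
proof -
  have q: "q permutes {1..6}" "q' permutes {1..6}"
    using assms by (auto simp: intertwines_def)
  define r where "r = inv' q' \<circ> q"
  have "r permutes {1..6}"
    unfolding r_def by (intro permutes_compose permutes_inv q)
  moreover have "r \<circ> dual a b = dual a b \<circ> r" if "a \<in> {1..6}" "b \<in> {1..6}" "a \<noteq> b" for a b
  proof -
    have "q \<circ> dual a b = dual (p a) (p b) \<circ> q" and *: "q' \<circ> dual a b = dual (p a) (p b) \<circ> q'"
      using assms that by (auto simp: intertwines_def)
    moreover have "inv' q' \<circ> dual (p a) (p b) = dual a b \<circ> inv' q'"
      using * permutes_inv_o[OF q(2)] by (metis comp_assoc comp_id id_comp)
    ultimately show ?thesis
      unfolding r_def by (metis comp_assoc)
  qed
  ultimately have "r = id"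
    by (rule commuting_with_dual)
  then show ?thesis
    using permutes_inv_o[OF q(2)] unfolding r_def by (metis comp_assoc comp_id id_comp)
qed

lemma intertwines_exists:
  assumes "p permutes {1..6}"
  shows "\<exists>q. intertwines p q \<and> intertwines q p \<and> sign q = sign p"
  using assms finite_atLeastAtMost[of 1 6]
proof (induction p rule: permutes_induct)
  case id
  then show ?case using intertwines_id by blast
next
  case (swap a b p)
  then obtain q where q: "intertwines p q" "intertwines q p" "sign q = sign p"
    by blast
  have "q permutes {1..6}"
    using q by (simp add: intertwines_def)
  note perm = permutes6_permutation[OF this] permutes6_permutation[OF swap(4)]
    permutes6_permutation[OF dual_permutes(1)[OF swap(1-3)]] permutation_swap_id[of a b]
  have "sign (dual a b \<circ> q) = sign (swp a b \<circ> p)"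
    using perm q(3) swap by (simp add: sign_compose dual_permutes sign_swap_id)
  moreover have "intertwines (swp a b \<circ> p) (dual a b \<circ> q)" "intertwines (dual a b \<circ> q) (swp a b \<circ> p)"
    using intertwines_swap[OF swap(1-3)] q by (auto intro: intertwines_comp)
  ultimately show ?case
    by (intro exI[of _ "dual a b \<circ> q"] conjI)
qed

definition outer :: "(nat \<Rightarrow> nat) \<Rightarrow> nat \<Rightarrow> nat" where
  "outer p = (THE q. intertwines p q)"

lemma outer_eqI: "intertwines p q \<Longrightarrow> outer p = q"
  unfolding outer_def using intertwines_unique by blast

lemma intertwines_outer: "p permutes {1..6} \<Longrightarrow> intertwines p (outer p)"
  using intertwines_exists outer_eqI by metis

lemma outer_permutes: "p permutes {1..6} \<Longrightarrow> outer p permutes {1..6}"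
  using intertwines_outer intertwines_def by blast

lemma outer_comp: "p permutes {1..6} \<Longrightarrow> q permutes {1..6} \<Longrightarrow> outer (p \<circ> q) = outer p \<circ> outer q"
  by (simp add: intertwines_comp intertwines_outer outer_eqI)

lemma outer_outer: "p permutes {1..6} \<Longrightarrow> outer (outer p) = p"
  using intertwines_exists outer_eqI by metis

lemma sign_outer: "p permutes {1..6} \<Longrightarrow> sign (outer p) = sign p"
  using intertwines_exists outer_eqI by metis

lemma outer_swap: "a \<in> {1..6} \<Longrightarrow> b \<in> {1..6} \<Longrightarrow> a \<noteq> b \<Longrightarrow> outer (swp a b) = dual a b"
  by (simp add: intertwines_swap outer_eqI)

lemma all_odd_order4_sound:
  assumes "1 \<le> n" "n \<le> 6" "p permutes {1..n}"
  shows "all_odd_order4 (map (\<lambda>i. (i, [1..<i])) [Suc n..<7]) (vals p) (vals (outer p)) (sign p = -1)"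
  using assms
proof (induction n arbitrary: p rule: dec_induct)
  case base
  then have "p = id" by (simp add: permutes_sing)
  moreover have "outer id = id" by (rule outer_eqI[OF intertwines_id])
  moreover have "map (\<lambda>i. (i, [1..<i])) [Suc 1..<7] =
      [(2,[1]),(3,[1,2]),(4,[1,2,3]),(5,[1,2,3,4]),(6,[1,2,3,4,5])]"
  proof -
    have "[Suc 1..<7] = [2,3,4,5,6]" "[1..<2] = [1]" "[1..<3] = [1,2]" "[1..<4] = [1,2,3]"
      "[1..<5] = [1,2,3,4]" "[1..<6] = [1,2,3,4,5::nat]"
      by code_simp+
    then show ?thesis by (simp only: list.map)
  qed
  moreover have "vals id = [1,2,3,4,5,6]" by (simp add: vals_def)
  ultimately show ?case
    using all_odd_order4_id by (simp only: sign_id) simp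
next
  case (step n)
  have "p \<in> {p. p permutes insert (Suc n) {1..n}}"
    using step.prems(2) by (simp add: atLeastAtMostSuc_conv)
  then obtain b r where p: "p = swp (Suc n) b \<circ> r" and b: "b \<in> insert (Suc n) {1..n}" and r: "r permutes {1..n}"
    unfolding permutes_insert by auto
  have r6: "r permutes {1..6}"
    using r step.prems by (auto elim: permutes_subset)
  have ok: "all_odd_order4 (map (\<lambda>i. (i, [1..<i])) [Suc n..<7]) (vals r) (vals (outer r)) (sign r = -1)"
    using step.IH r step.prems by simp
  have upt: "[Suc n..<7] = Suc n # [Suc (Suc n)..<7]"
    using step.prems by (simp add: upt_conv_Cons)
  show ?case
  proof (cases "b = Suc n")
    case True
    then show ?thesis using ok p by (simp add: upt all_odd_order4_branch)
  next
    case False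
    then have bn: "b \<in> {1..6}" "Suc n \<in> {1..6}" "Suc n \<noteq> b" "b \<in> set [1..<Suc n]"
      using b step.prems by auto
    have sw: "swp (Suc n) b permutes {1..6}"
      using bn by (intro permutes_swap_id)
    have 1: "map (swp (Suc n) b) (vals r) = vals p"
      by (simp add: p vals_def)
    have 2: "map (app (dual_list (Suc n) b)) (vals (outer r)) = vals (outer p)"
      using bn r6 sw by (simp add: p outer_comp outer_swap dual_permutes map_app_vals outer_permutes)
    have 3: "(\<not> sign r = -1) = (sign p = -1)"
    proof -
      have "sign p = - sign r"
        using bn(3) permutes6_permutation[OF r6]
        by (simp add: p sign_compose sign_swap_id permutation_swap_id)
      then show ?thesis by (cases r rule: sign_cases) simp_all
    qed
    have "all_odd_order4 (map (\<lambda>i. (i, [1..<i])) [Suc (Suc n)..<7]) (map (swp (Suc n) b) (vals r))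
        (map (app (dual_list (Suc n) b)) (vals (outer r))) (\<not> sign r = -1)"
      using ok[unfolded upt list.map all_odd_order4_branch] bn(4) by blast
    then show ?thesis
      unfolding 1 2 3 .
  qed
qed

text \<open>
  In \<open>Aut(A\<^sub>6)\<close>, written as \<open>S\<^sub>6\<close> extended by the involution \<open>outer\<close>, the product \<open>p \<circ> outer p\<close> is the square
  of the element \<open>p\<close> times \<open>outer\<close>.  For odd \<open>p\<close> these elements form the coset \<open>M\<^sub>1\<^sub>0 - A\<^sub>6\<close>, all of whose
  elements have order 4 or 8.
\<close>

lemma odd_outer_order4:
  assumes p: "p permutes {1..6}" and "sign p = -1"
  defines "w \<equiv> p \<circ> outer p"
  shows "(w \<circ> w) \<circ> (w \<circ> w) = id"
proof -
  have w: "w permutes {1..6}" "w \<circ> w permutes {1..6}" "w \<circ> w \<circ> (w \<circ> w) permutes {1..6}"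
    unfolding w_def using p by (auto intro!: permutes_compose outer_permutes)
  have "all_odd_order4 [] (vals p) (vals (outer p)) True"
    using all_odd_order4_sound[of 6 p] assms by simp
  then have "vals (w \<circ> w \<circ> (w \<circ> w)) = vals id"
    using p w by (simp add: all_odd_order4.simps map_app_vals outer_permutes flip: w_def) (simp add: vals_def)
  then show ?thesis
    using app_vals[OF w(3)] app_vals[OF permutes_id] by metis
qed

text \<open>
  Conjugation by a fixed element of \<open>M\<^sub>1\<^sub>0 - A\<^sub>6\<close>, namely the transposition \<open>(1 2)\<close> times \<open>outer\<close>, restricted
  to \<open>A\<^sub>6\<close>.  Here \<open>u\<close> is the square of that element, and \<open>a \<circ> \<tau> a \<circ> u\<close> is the square of \<open>a\<close> times it, so the
  last clause says that the whole coset consists of elements of order dividing 8.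
\<close>

lemma alt_group_6_twist:
  obtains \<tau> u where "\<tau> \<in> hom (alt_group 6) (alt_group 6)" and "u \<in> carrier (alt_group 6)" and "\<tau> u = u"
    and "\<And>a. a \<in> carrier (alt_group 6) \<Longrightarrow> \<tau> (\<tau> a) \<circ> u = u \<circ> a"
    and "\<And>a. a \<in> carrier (alt_group 6) \<Longrightarrow> ((a \<circ> \<tau> a \<circ> u) ^^ 4) = id"
proof -
  define t :: "nat \<Rightarrow> nat" where "t = swp 1 2"
  have t: "t permutes {1..6}" "sign t = -1" "t \<circ> t = id"
    unfolding t_def by (auto intro: permutes_swap_id simp: sign_swap_id)
  define \<tau> where "\<tau> = (\<lambda>a. t \<circ> outer a \<circ> t)"
  define u where "u = t \<circ> outer t"
  have tt: "t \<circ> (t \<circ> f) = f" for f :: "nat \<Rightarrow> nat"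
    using t(3) by (metis comp_assoc id_comp)
  have ott: "outer t \<circ> outer t = id"
    using outer_comp[OF t(1) t(1)] t(3) outer_eqI[OF intertwines_id] by simp
  have car: "a \<in> carrier (alt_group 6) \<longleftrightarrow> a permutes {1..6} \<and> sign a = 1" for a
    by (auto simp: alt_group_carrier sign_def)
  have comp_closed: "p \<circ> q permutes {1..6}" and comp_sign: "sign (p \<circ> q) = sign p * sign q"
    if "p permutes {1..6}" "q permutes {1..6}" for p q :: "nat \<Rightarrow> nat"
    using that by (auto intro: permutes_compose simp: sign_compose permutes6_permutation)
  have u: "u permutes {1..6}" "sign u = 1"
    using t by (simp_all add: u_def comp_closed comp_sign outer_permutes sign_outer)
  have \<tau>: "\<tau> a permutes {1..6}" "sign (\<tau> a) = sign a" if "a permutes {1..6}" for a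
    using t that by (simp_all add: \<tau>_def comp_closed comp_sign outer_permutes sign_outer)
  have \<tau>\<tau>: "\<tau> (\<tau> a) = t \<circ> outer t \<circ> a \<circ> outer t \<circ> t" if "a permutes {1..6}" for a
    using t(1) that
    by (simp add: \<tau>_def outer_comp outer_permutes outer_outer comp_closed) (simp add: comp_assoc)
  show thesis
  proof
    show "\<tau> \<in> hom (alt_group 6) (alt_group 6)"
    proof (rule homI)
      show "\<tau> a \<in> carrier (alt_group 6)" if "a \<in> carrier (alt_group 6)" for a
        using that by (simp add: car \<tau>)
      show "\<tau> (a \<otimes>\<^bsub>alt_group 6\<^esub> b) = \<tau> a \<otimes>\<^bsub>alt_group 6\<^esub> \<tau> b"
        if "a \<in> carrier (alt_group 6)" "b \<in> carrier (alt_group 6)" for a b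
        using that tt[of "outer b \<circ> t"] by (simp add: car alt_group_mult \<tau>_def outer_comp comp_assoc)
    qed
    show "u \<in> carrier (alt_group 6)"
      using u by (simp add: car)
    have "outer u = outer t \<circ> t"
      using t(1) by (simp add: u_def outer_comp outer_permutes outer_outer)
    then show "\<tau> u = u"
      using t(3) by (simp add: \<tau>_def u_def comp_assoc)
    fix a assume "a \<in> carrier (alt_group 6)"
    then have a: "a permutes {1..6}" "sign a = 1" by (auto simp: car)
    have "\<tau> (\<tau> a) \<circ> u = t \<circ> outer t \<circ> a \<circ> (outer t \<circ> (t \<circ> (t \<circ> outer t)))"
      using \<tau>\<tau>[OF a(1)] by (simp add: u_def comp_assoc)
    also have "\<dots> = u \<circ> a"
      unfolding tt ott by (simp add: u_def)
    finally show "\<tau> (\<tau> a) \<circ> u = u \<circ> a" .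
    have "a \<circ> \<tau> a \<circ> u = (a \<circ> t) \<circ> (outer a \<circ> (t \<circ> (t \<circ> outer t)))"
      by (simp add: \<tau>_def u_def comp_assoc)
    also have "\<dots> = (a \<circ> t) \<circ> outer (a \<circ> t)"
      unfolding tt using a t by (simp add: outer_comp)
    finally have w: "a \<circ> \<tau> a \<circ> u = (a \<circ> t) \<circ> outer (a \<circ> t)" .
    have "sign (a \<circ> t) = -1"
      using a t by (simp add: comp_sign)
    then have "((a \<circ> t) \<circ> outer (a \<circ> t)) ^^ (2 + 2) = id"
      unfolding funpow_add using odd_outer_order4[of "a \<circ> t"] comp_closed[OF a(1) t(1)]
      by (simp add: numeral_2_eq_2)
    then show "((a \<circ> \<tau> a \<circ> u) ^^ 4) = id"
      by (simp add: w)
  qed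
qed

declare One_nat_def [simp]

section \<open>Cyclic extensions\<close>

text \<open>
  The data of an extension of \<open>B\<close> by \<open>\<int>/M\<close>: a generator \<open>z\<close> of the quotient acts on \<open>B\<close> by \<open>\<zeta>\<close>, and
  \<open>z\<^sup>M = U\<close>.  Since \<open>z\<^sup>M\<close> must commute with \<open>z\<close> and act as conjugation by \<open>U\<close>, the two equations on \<open>\<zeta>\<close> are
  forced.  The pair \<open>(j, b)\<close> stands for \<open>b z\<^sup>j\<close>.
\<close>

locale cyclic_extension = group B for B :: "('b, 'm) monoid_scheme" (structure) +
  fixes \<zeta> :: "'b \<Rightarrow> 'b" and U :: 'b and M :: nat
  assumes zeta_hom: "\<zeta> \<in> hom B B"
    and U_closed [simp]: "U \<in> carrier B"
    and zeta_U: "\<zeta> U = U"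
    and zeta_M: "b \<in> carrier B \<Longrightarrow> (\<zeta> ^^ M) b \<otimes> U = U \<otimes> b"
    and M_pos: "M > 0"
begin

definition ext :: "(nat \<times> 'b) monoid" where
  "ext = \<lparr>carrier = {..<M} \<times> carrier B,
     mult = (\<lambda>(j, a) (l, b). ((j + l) mod M, a \<otimes> (\<zeta> ^^ j) b \<otimes> U [^] ((j + l) div M))),
     one = (0, \<one>)\<rparr>"

lemma carrier_ext [simp]: "carrier ext = {..<M} \<times> carrier B"
  and one_ext [simp]: "\<one>\<^bsub>ext\<^esub> = (0, \<one>)"
  and mult_ext [simp]: "(j, a) \<otimes>\<^bsub>ext\<^esub> (l, b) = ((j + l) mod M, a \<otimes> (\<zeta> ^^ j) b \<otimes> U [^] ((j + l) div M))"
  by (simp_all add: ext_def)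

lemma funpow_hom: "\<zeta> ^^ n \<in> hom B B"
proof (induction n)
  case 0
  then show ?case by (simp add: hom_def)
next
  case (Suc n)
  then show ?case using zeta_hom by (auto simp: hom_def Pi_iff)
qed

lemma funpow_closed [simp]: "b \<in> carrier B \<Longrightarrow> (\<zeta> ^^ n) b \<in> carrier B"
  using funpow_hom by (auto simp: hom_def)

lemma funpow_mult: 
  "a \<in> carrier B \<Longrightarrow> b \<in> carrier B \<Longrightarrow> (\<zeta> ^^ n) (a \<otimes> b) = (\<zeta> ^^ n) a \<otimes> (\<zeta> ^^ n) b"
  using funpow_hom by (auto simp: hom_def)

lemma funpow_U_pow: "(\<zeta> ^^ n) (U [^] (k::nat)) = U [^] k"
proof -
  have "(\<zeta> ^^ n) U = U"
    by (induction n) (simp_all add: zeta_U)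
  then show ?thesis
    by (induction k) (simp_all add: funpow_mult hom_one[OF funpow_hom])
qed

text \<open>The carry rule: each full turn \<open>z\<^sup>M\<close> contained in \<open>z\<^sup>n\<close> may be traded for a factor \<open>U\<close>.\<close>

lemma funpow_mod:
  assumes "b \<in> carrier B"
  shows "(\<zeta> ^^ n) b \<otimes> U [^] (n div M) = U [^] (n div M) \<otimes> (\<zeta> ^^ (n mod M)) b"
proof -
  have "(\<zeta> ^^ (q * M + r)) b \<otimes> U [^] q = U [^] q \<otimes> (\<zeta> ^^ r) b" for q r
  proof (induction q)
    case 0
    then show ?case using assms by simp
  next
    case (Suc q)
    let ?c = "(\<zeta> ^^ (q * M + r)) b"
    have U: "U [^] Suc q = U \<otimes> U [^] q" by (rule nat_pow_Suc2) simp
    have "(\<zeta> ^^ (Suc q * M + r)) b \<otimes> U [^] Suc q = (\<zeta> ^^ M) ?c \<otimes> U \<otimes> U [^] q"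
      using assms unfolding U by (simp add: funpow_add add.assoc m_assoc)
    also have "\<dots> = U \<otimes> (?c \<otimes> U [^] q)"
      using assms by (simp add: zeta_M m_assoc)
    also have "\<dots> = U [^] Suc q \<otimes> (\<zeta> ^^ r) b"
      using assms unfolding U Suc.IH by (simp add: m_assoc)
    finally show ?case .
  qed
  from this[of "n div M" "n mod M"] show ?thesis by simp
qed

lemma group_ext: "group ext"
proof (rule groupI)
  show "\<one>\<^bsub>ext\<^esub> \<in> carrier ext" using M_pos by simp
  show "x \<otimes>\<^bsub>ext\<^esub> y \<in> carrier ext" if "x \<in> carrier ext" "y \<in> carrier ext" for x y
    using that M_pos by (cases x; cases y) auto
  show "\<one>\<^bsub>ext\<^esub> \<otimes>\<^bsub>ext\<^esub> x = x" if "x \<in> carrier ext" for x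
    using that by (cases x) auto
  show "x \<otimes>\<^bsub>ext\<^esub> y \<otimes>\<^bsub>ext\<^esub> z = x \<otimes>\<^bsub>ext\<^esub> (y \<otimes>\<^bsub>ext\<^esub> z)"
    if "x \<in> carrier ext" "y \<in> carrier ext" "z \<in> carrier ext" for x y z
  proof -
    obtain j a l b r c where xyz: "x = (j, a)" "y = (l, b)" "z = (r, c)"
      by (cases x; cases y; cases z)
    have car: "a \<in> carrier B" "b \<in> carrier B" "c \<in> carrier B"
      using that xyz by auto
    let ?q = "(j + l) div M" and ?s = "((j + l) mod M + r) div M"
    let ?d = "(l + r) div M" and ?e = "(j + (l + r) mod M) div M"
    (* Both bracketings collect the number of full turns in j + l + r. *)
    have div_add: "(x + y) div M = x div M + (x mod M + y) div M" for x y
    proof -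
      have "x + y = (x mod M + y) + x div M * M" by simp
      then have "(x + y) div M = ((x mod M + y) + x div M * M) div M" by (rule arg_cong)
      also have "\<dots> = x div M + (x mod M + y) div M"
        using M_pos by (subst div_mult_self1) auto
      finally show ?thesis .
    qed
    have carry: "?q + ?s = ?d + ?e"
      using div_add[of "j + l" r] div_add[of "l + r" j] by (simp add: ac_simps)
    have "a \<otimes> (\<zeta> ^^ j) b \<otimes> U [^] ?q \<otimes> (\<zeta> ^^ ((j + l) mod M)) c \<otimes> U [^] ?s
        = a \<otimes> (\<zeta> ^^ j) b \<otimes> (U [^] ?q \<otimes> (\<zeta> ^^ ((j + l) mod M)) c) \<otimes> U [^] ?s"
      using car by (simp add: m_assoc)
    also have "\<dots> = a \<otimes> (\<zeta> ^^ j) b \<otimes> (\<zeta> ^^ (j + l)) c \<otimes> U [^] (?q + ?s)"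
      using car by (simp add: m_assoc nat_pow_mult flip: funpow_mod)
    also have "\<dots> = a \<otimes> (\<zeta> ^^ j) b \<otimes> (\<zeta> ^^ j) ((\<zeta> ^^ l) c) \<otimes> U [^] (?d + ?e)"
      by (simp add: carry funpow_add)
    also have "\<dots> = a \<otimes> (\<zeta> ^^ j) (b \<otimes> (\<zeta> ^^ l) c \<otimes> U [^] ?d) \<otimes> U [^] ?e"
      using car by (simp add: funpow_mult funpow_U_pow m_assoc nat_pow_mult)
    finally show ?thesis
      using car by (simp add: xyz mod_add_left_eq mod_add_right_eq add.assoc)
  qed
  show "\<exists>y\<in>carrier ext. y \<otimes>\<^bsub>ext\<^esub> x = \<one>\<^bsub>ext\<^esub>" if x': "x \<in> carrier ext" for x
  proof -
    obtain j a where x: "x = (j, a)" and j: "j < M" and a: "a \<in> carrier B"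
      using x' by (cases x) auto
    let ?i = "(M - j) mod M"
    have i: "?i < M" "(?i + j) mod M = 0"
      using j by (auto simp: mod_add_left_eq)
    define c where "c = (\<zeta> ^^ ?i) a \<otimes> U [^] ((?i + j) div M)"
    have "c \<in> carrier B" using a by (simp add: c_def)
    then have "(?i, inv c) \<otimes>\<^bsub>ext\<^esub> x = \<one>\<^bsub>ext\<^esub>"
      using a i by (simp add: x m_assoc flip: c_def)
    then show ?thesis
      using i \<open>c \<in> carrier B\<close> by force
  qed
qed

lemma fst_pow_ext:
  assumes "x \<in> carrier ext"
  shows "fst (x [^]\<^bsub>ext\<^esub> (n::nat)) = (fst x * n) mod M"
proof (induction n)
  case 0
  then show ?case by simp
next
  case (Suc n)
  then show ?case
    by (cases x; cases "x [^]\<^bsub>ext\<^esub> n") (simp add: mod_add_left_eq mod_add_right_eq add.commute)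
qed

end

section \<open>Profinite groups on products of finite sets\<close>

lemma openin_product_discrete_iff:
  assumes unbounded: "\<And>n::nat. \<exists>k. n \<le> r k"
  shows "openin (product_topology (\<lambda>i. discrete_topology (C i)) UNIV) U \<longleftrightarrow>
    U \<subseteq> Pi UNIV C \<and> (\<forall>x\<in>U. \<exists>k. {y \<in> Pi UNIV C. \<forall>i<r k. y i = x i} \<subseteq> U)"
  (is "openin ?T U \<longleftrightarrow> ?R")
proof
  assume U: "openin ?T U"
  show ?R
  proof (intro conjI ballI)
    show "U \<subseteq> Pi UNIV C"
      using openin_subset[OF U] by (auto simp: PiE_UNIV_domain)
    fix x assume "x \<in> U"
    then obtain V where V: "finite {i. V i \<noteq> C i}" "x \<in> Pi\<^sub>E UNIV V" "Pi\<^sub>E UNIV V \<subseteq> U"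
      using U unfolding openin_product_topology_alt by auto
    then obtain n where n: "\<forall>i\<in>{i. V i \<noteq> C i}. i < n"
      using finite_nat_set_iff_bounded by blast
    obtain k where k: "n \<le> r k" using unbounded by blast
    have "{y \<in> Pi UNIV C. \<forall>i<r k. y i = x i} \<subseteq> Pi\<^sub>E UNIV V"
    proof
      fix y assume y: "y \<in> {y \<in> Pi UNIV C. \<forall>i<r k. y i = x i}"
      have "y i \<in> V i" for i
      proof (cases "V i = C i")
        case False
        then have "i < r k" using n k by fastforce
        then show ?thesis using y V(2) by auto
      qed (use y in auto)
      then show "y \<in> Pi\<^sub>E UNIV V" by auto
    qed
    with V(3) show "\<exists>k. {y \<in> Pi UNIV C. \<forall>i<r k. y i = x i} \<subseteq> U" by blast
  qed
next
  assume R: ?R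
  show "openin ?T U"
    unfolding openin_product_topology_alt
  proof (intro ballI)
    fix x assume x: "x \<in> U"
    with R obtain k where k: "{y \<in> Pi UNIV C. \<forall>i<r k. y i = x i} \<subseteq> U" by blast
    have xC: "x i \<in> C i" for i using R x by auto
    let ?V = "\<lambda>i. if i < r k then {x i} else C i"
    have "finite {i. ?V i \<noteq> C i}"
      by (rule finite_subset[of _ "{..<r k}"]) auto
    moreover have "Pi\<^sub>E UNIV ?V \<subseteq> U"
    proof
      fix y assume y': "y \<in> Pi\<^sub>E UNIV ?V"
      have y: "y i \<in> ?V i" for i by (rule PiE_mem[OF y' UNIV_I])
      have "y i \<in> C i" for i using y[of i] xC by (auto split: if_splits)
      moreover have "y i = x i" if "i < r k" for i using y[of i] that by auto
      ultimately show "y \<in> U" using k by auto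
    qed
    ultimately show "\<exists>U'. finite {i \<in> UNIV. U' i \<noteq> topspace (discrete_topology (C i))} \<and>
       (\<forall>i\<in>UNIV. openin (discrete_topology (C i)) (U' i)) \<and> x \<in> Pi\<^sub>E UNIV U' \<and> Pi\<^sub>E UNIV U' \<subseteq> U"
      using xC by (intro exI[of _ ?V]) auto
  qed
qed

lemma totally_disconnected_product_discrete:
  "totally_disconnected_space (product_topology (\<lambda>i. discrete_topology (C i)) UNIV)"
  unfolding totally_disconnected_space_def
proof (intro allI impI)
  fix S assume S: "connectedin (product_topology (\<lambda>i. discrete_topology (C i)) UNIV) S"
  have "\<exists>a. (\<lambda>x. x i) ` S \<subseteq> {a}" for i
  proof -
    have "continuous_map (product_topology (\<lambda>i. discrete_topology (C i)) UNIV) (discrete_topology (C i)) (\<lambda>x. x i)"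
      by (rule continuous_map_product_projection) simp
    from connectedin_continuous_map_image[OF this S] show ?thesis
      by (simp add: connectedin_discrete_topology)
  qed
  then have "x = y" if "x \<in> S" "y \<in> S" for x y
    using that by (metis ext image_subset_iff singletonD)
  then show "\<exists>x. S \<subseteq> {x}" by blast
qed

text \<open>
  The property proved for all measurable sets is that \<open>A\<close> and its complement have open supersets whose
  overlap is small.  It is symmetric in \<open>A\<close> and its complement and trivial for clopen sets, so the only
  work is the countable union, where finitely many of the complementary sets suffice by continuity of the
  measure.
\<close>

lemma (in finite_measure) emeasure_outer_regular:
  assumes gen: "sets M = sigma_sets (space M) {A. A \<subseteq> space M \<and> openin T A \<and> closedin T A}"
    and T: "topspace T = space M" and open_sets: "\<And>U. openin T U \<Longrightarrow> U \<in> sets M"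
    and A: "A \<in> sets M"
  shows "emeasure M A = (INF U \<in> {U. openin T U \<and> A \<subseteq> U}. emeasure M U)"
proof -
  have "A \<in> sigma_sets (space M) {A. A \<subseteq> space M \<and> openin T A \<and> closedin T A}"
    using A gen by simp
  then have approx: "\<exists>U V. openin T U \<and> openin T V \<and> A \<subseteq> U \<and> space M - A \<subseteq> V \<and> measure M (U \<inter> V) < e"
    if "e > 0" for e :: real
    using that
  proof (induction arbitrary: e rule: sigma_sets.induct)
    case (Basic a)
    moreover from this have "openin T (space M - a)"
      by (simp add: closedin_def T)
    moreover have "a \<inter> (space M - a) = {}" by blast
    ultimately show ?case
      using \<open>e > 0\<close> by (intro exI[of _ a] exI[of _ "space M - a"]) simp
  next
    case Empty
    then show ?case
      using openin_topspace[of T] T by (intro exI[of _ "{}"] exI[of _ "space M"]) simp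
  next
    case (Compl a)
    from Compl.IH[OF Compl.prems] obtain U V
      where "openin T U" "openin T V" "a \<subseteq> U" "space M - a \<subseteq> V" "measure M (U \<inter> V) < e" by blast
    moreover have "a \<subseteq> space M"
      using Compl.hyps sigma_sets_into_sp[of "{A. A \<subseteq> space M \<and> openin T A \<and> closedin T A}" "space M"] by blast
    ultimately show ?case
      by (intro exI[of _ V] exI[of _ U]) (simp add: Int_commute double_diff)
  next
    case (Union a)
    have pos: "e / 2 * (1/2) ^ Suc i > 0" for i :: nat
      using Union.prems by simp
    from Union.IH[OF pos] have "\<forall>i. \<exists>U V. openin T U \<and> openin T V \<and> a i \<subseteq> U \<and> space M - a i \<subseteq> V \<and>
        measure M (U \<inter> V) < e / 2 * (1/2) ^ Suc i"
      by blast
    then obtain U V where UV: "\<And>i. openin T (U i)" "\<And>i. openin T (V i)" "\<And>i. a i \<subseteq> U i"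
      "\<And>i. space M - a i \<subseteq> V i" "\<And>i. measure M (U i \<inter> V i) < e / 2 * (1/2) ^ Suc i"
      by metis
    have s: "U i \<in> sets M" "V i \<in> sets M" for i
      using UV open_sets by auto
    have "(\<lambda>n. measure M (\<Union>i<n. U i)) \<longlonglongrightarrow> measure M (\<Union>n. \<Union>i<n. U i)"
    proof (rule finite_Lim_measure_incseq)
      show "range (\<lambda>n. \<Union>i<n. U i) \<subseteq> sets M" using s by auto
      show "incseq (\<lambda>n. \<Union>i<n. U i)" by (intro monoI UN_mono) auto
    qed
    moreover have "(\<Union>n. \<Union>i<n. U i) = (\<Union>i. U i)" by auto
    ultimately have "(\<lambda>n. measure M (\<Union>i<n. U i)) \<longlonglongrightarrow> measure M (\<Union>i. U i)" by simp
    then obtain n where n: "measure M (\<Union>i. U i) - measure M (\<Union>i<n. U i) < e / 2"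
    proof -
      have "e / 2 > 0" using Union.prems by simp
      from metric_LIMSEQ_D[OF \<open>_ \<longlonglongrightarrow> measure M (\<Union>i. U i)\<close> this] obtain n
        where "dist (measure M (\<Union>i<n. U i)) (measure M (\<Union>i. U i)) < e / 2" by blast
      then show thesis
        unfolding dist_real_def by (intro that[of n]) linarith
    qed
    let ?W = "space M \<inter> (\<Inter>i<n. V i)"
    have W: "openin T ?W"
    proof (cases "n = 0")
      case True
      then show ?thesis using openin_topspace[of T] T by simp
    next
      case False
      then have "openin T (\<Inter>i\<in>{..<n}. V i)"
        using UV by (intro openin_Inter) auto
      then show ?thesis using T by (metis openin_Int openin_topspace)
    qed
    have "measure M ((\<Union>i. U i) \<inter> ?W) \<le> measure M ((\<Union>i<n. U i \<inter> V i) \<union> ((\<Union>i. U i) - (\<Union>i<n. U i)))"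
      using s by (intro finite_measure_mono) auto
    also have "\<dots> \<le> measure M (\<Union>i<n. U i \<inter> V i) + measure M ((\<Union>i. U i) - (\<Union>i<n. U i))"
      using s by (intro measure_Un_le) auto
    also have "measure M ((\<Union>i. U i) - (\<Union>i<n. U i)) = measure M (\<Union>i. U i) - measure M (\<Union>i<n. U i)"
      using s by (intro finite_measure_Diff) auto
    also have "measure M (\<Union>i<n. U i \<inter> V i) \<le> (\<Sum>i<n. measure M (U i \<inter> V i))"
      using s by (intro finite_measure_subadditive_finite) auto
    also have "(\<Sum>i<n. measure M (U i \<inter> V i)) \<le> (\<Sum>i<n. e / 2 * (1/2) ^ Suc i)"
      using UV(5) by (intro sum_mono less_imp_le)
    also have "(\<Sum>i<n. e / 2 * (1/2) ^ Suc i) = e / 2 * (1 - (1/2) ^ n)"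
      by (induction n) (simp_all add: field_simps)
    also have "\<dots> \<le> e / 2"
      using Union.prems by (simp add: field_simps)
    finally have "measure M ((\<Union>i. U i) \<inter> ?W) < e"
      using n by linarith
    moreover have "openin T (\<Union>i. U i)" using UV by blast
    moreover have "(\<Union>i. a i) \<subseteq> (\<Union>i. U i)"
      by (intro UN_mono UV(3)) simp
    moreover have "space M - (\<Union>i. a i) \<subseteq> ?W"
      using UV(4) by fastforce
    ultimately show ?case using W by (intro exI[of _ "\<Union>i. U i"] exI[of _ ?W]) simp
  qed
  show ?thesis
  proof (rule antisym)
    show "emeasure M A \<le> (INF U \<in> {U. openin T U \<and> A \<subseteq> U}. emeasure M U)"
      using open_sets by (intro INF_greatest emeasure_mono) auto
    show "(INF U \<in> {U. openin T U \<and> A \<subseteq> U}. emeasure M U) \<le> emeasure M A"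
    proof (rule ennreal_le_epsilon)
      fix e :: real assume "0 < e"
      from approx[OF this] obtain U V where UV: "openin T U" "openin T V" "A \<subseteq> U" "space M - A \<subseteq> V"
        "measure M (U \<inter> V) < e" by blast
      have s: "U \<in> sets M" "V \<in> sets M" using UV open_sets by auto
      have "U \<subseteq> A \<union> (U \<inter> V)"
        using UV sets.sets_into_space[OF s(1)] by blast
      then have "measure M U \<le> measure M (A \<union> (U \<inter> V))"
        using s A by (intro finite_measure_mono) auto
      also have "\<dots> \<le> measure M A + measure M (U \<inter> V)"
        using s A by (intro measure_Un_le) auto
      finally have "measure M U \<le> measure M A + e"
        using UV by simp
      then have "emeasure M U \<le> emeasure M A + ennreal e"
        using \<open>0 < e\<close> by (simp add: emeasure_eq_measure flip: ennreal_plus)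
      moreover have "(INF U \<in> {U. openin T U \<and> A \<subseteq> U}. emeasure M U) \<le> emeasure M U"
        using UV by (intro INF_lower) auto
      ultimately show "(INF U \<in> {U. openin T U \<and> A \<subseteq> U}. emeasure M U) \<le> emeasure M A + ennreal e"
        by (rule order_trans[rotated])
    qed
  qed
qed

text \<open>
  A group structure on a product of finite sets in which, for unboundedly many \<open>r k\<close>, the first \<open>r k\<close>
  coordinates of a product depend only on the first \<open>r k\<close> coordinates of the factors.  Such a group is the
  inverse limit of its finite truncations, hence profinite in the product topology.  Moreover the fibres of
  a truncation are cosets and all have the same measure, so the product of the uniform measures is the Haar
  measure.
\<close>

locale coordinate_group = group G for G :: "(nat \<Rightarrow> 'a) monoid" (structure) +
  fixes C :: "nat \<Rightarrow> 'a set" and r :: "nat \<Rightarrow> nat"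
  assumes finite_C: "finite (C i)"
    and carrier_eq: "carrier G = Pi UNIV C"
    and agree_mult: "\<lbrakk>x \<in> carrier G; x' \<in> carrier G; y \<in> carrier G; y' \<in> carrier G;
      \<forall>i<r k. x i = x' i; \<forall>i<r k. y i = y' i\<rbrakk> \<Longrightarrow> \<forall>i<r k. (x \<otimes> y) i = (x' \<otimes> y') i"
    and r_unbounded: "\<exists>k. n \<le> r k"
begin

definition T :: "(nat \<Rightarrow> 'a) topology" where
  "T = product_topology (\<lambda>i. discrete_topology (C i)) UNIV"

definition cyl :: "nat \<Rightarrow> (nat \<Rightarrow> 'a) \<Rightarrow> (nat \<Rightarrow> 'a) set" where
  "cyl k x = {y \<in> carrier G. \<forall>i<r k. y i = x i}"

lemma topspace_T [simp]: "topspace T = carrier G"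
  by (simp add: T_def carrier_eq PiE_UNIV_domain)

lemma openin_T: "openin T U \<longleftrightarrow> U \<subseteq> carrier G \<and> (\<forall>x\<in>U. \<exists>k. cyl k x \<subseteq> U)"
  unfolding T_def cyl_def carrier_eq by (rule openin_product_discrete_iff[OF r_unbounded])

lemma in_cyl: "x \<in> carrier G \<Longrightarrow> x \<in> cyl k x"
  by (simp add: cyl_def)

lemma cyl_subset: "cyl k x \<subseteq> carrier G"
  by (auto simp: cyl_def)

lemma cyl_eq: "y \<in> cyl k x \<Longrightarrow> cyl k y = cyl k x"
  by (auto simp: cyl_def)

lemma cyl_antimono: "r k \<le> r l \<Longrightarrow> cyl l x \<subseteq> cyl k x"
  by (auto simp: cyl_def)

lemma openin_cyl: "openin T (cyl k x)"
  unfolding openin_T using cyl_subset cyl_eq by blast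

lemma closedin_cyl: "closedin T (cyl k x)"
proof -
  have "openin T (carrier G - cyl k x)"
    unfolding openin_T
  proof (intro conjI ballI)
    fix y assume "y \<in> carrier G - cyl k x"
    then have "cyl k y \<subseteq> carrier G - cyl k x"
      by (auto simp: cyl_def)
    then show "\<exists>k'. cyl k' y \<subseteq> carrier G - cyl k x" by blast
  qed auto
  then show ?thesis using cyl_subset by (simp add: closedin_def)
qed

lemma mult_cyl:
  "\<lbrakk>x' \<in> cyl k x; y' \<in> cyl k y; x \<in> carrier G; y \<in> carrier G\<rbrakk> \<Longrightarrow> x' \<otimes> y' \<in> cyl k (x \<otimes> y)"
  using agree_mult[of x' x y' y] by (auto simp: cyl_def)

text \<open>
  Only products are assumed to respect truncation.  Replacing the middle factor \<open>x\<close> of \<open>inv x' \<otimes> x \<otimes> inv x\<close> by \<open>x'\<close>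
  leaves the truncation unchanged and turns \<open>inv x'\<close> into \<open>inv x\<close>.
\<close>

lemma inv_cyl:
  assumes "x' \<in> cyl k x" "x \<in> carrier G"
  shows "inv x' \<in> cyl k (inv x)"
proof -
  have x': "x' \<in> carrier G" using assms by (simp add: cyl_def)
  have "x \<in> cyl k x'"
    using assms by (auto simp: cyl_def)
  then have "inv x' \<otimes> x \<otimes> inv x \<in> cyl k (inv x' \<otimes> x' \<otimes> inv x)"
    using assms x' by (intro mult_cyl in_cyl) auto
  then show ?thesis
    using assms x' by (simp add: m_assoc)
qed

lemma l_coset_cyl:
  assumes g: "g \<in> carrier G" and x: "x \<in> carrier G"
  shows "g <# cyl k x = cyl k (g \<otimes> x)"
proof
  show "g <# cyl k x \<subseteq> cyl k (g \<otimes> x)"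
    using assms mult_cyl[OF in_cyl] by (auto simp: l_coset_def)
  show "cyl k (g \<otimes> x) \<subseteq> g <# cyl k x"
  proof
    fix z assume z: "z \<in> cyl k (g \<otimes> x)"
    then have "inv g \<otimes> z \<in> cyl k (inv g \<otimes> (g \<otimes> x))"
      using assms by (intro mult_cyl in_cyl) auto
    then have "inv g \<otimes> z \<in> cyl k x"
      using assms by (simp flip: m_assoc)
    moreover have "z = g \<otimes> (inv g \<otimes> z)"
      using assms z by (auto simp: cyl_def simp flip: m_assoc)
    ultimately show "z \<in> g <# cyl k x"
      by (auto simp: l_coset_def)
  qed
qed

lemma cyl_one_normal: "cyl k \<one> \<lhd> G"
proof -
  have "subgroup (cyl k \<one>) G"
  proof (rule subgroupI)
    show "cyl k \<one> \<subseteq> carrier G" "cyl k \<one> \<noteq> {}"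
      using cyl_subset in_cyl[OF one_closed, of k] by auto
    show "inv a \<in> cyl k \<one>" if "a \<in> cyl k \<one>" for a
      using inv_cyl[OF that] by simp
    show "a \<otimes> b \<in> cyl k \<one>" if "a \<in> cyl k \<one>" "b \<in> cyl k \<one>" for a b
      using mult_cyl[OF that] by simp
  qed
  moreover have "x \<otimes> h \<otimes> inv x \<in> cyl k \<one>" if x: "x \<in> carrier G" and h: "h \<in> cyl k \<one>" for x h
  proof -
    have "x \<otimes> h \<otimes> inv x \<in> cyl k (x \<otimes> \<one> \<otimes> inv x)"
      using x h by (intro mult_cyl in_cyl) auto
    then show ?thesis using x by simp
  qed
  ultimately show ?thesis
    unfolding normal_inv_iff by blast
qed

lemma open_contains_cyl_one:
  assumes "openin T U" "\<one> \<in> U"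
  obtains k where "cyl k \<one> \<subseteq> U"
  using assms openin_T by blast

lemma topological_group_T: "topological_group G T"
  unfolding topological_group_def
proof (intro conjI)
  show "group G" by (rule is_group)
  show "continuous_map (prod_topology T T) T (\<lambda>(x, y). x \<otimes> y)"
    unfolding continuous_map_def
  proof (intro conjI allI impI)
    fix U assume U: "openin T U"
    show "openin (prod_topology T T)
        {p \<in> topspace (prod_topology T T). (case p of (x, y) \<Rightarrow> x \<otimes> y) \<in> U}" (is "openin _ ?P")
      unfolding openin_prod_topology_alt
    proof (intro allI impI)
      fix x y assume "(x, y) \<in> ?P"
      then have xy: "x \<in> carrier G" "y \<in> carrier G" "x \<otimes> y \<in> U" by auto
      then obtain k where "cyl k (x \<otimes> y) \<subseteq> U"
        using U openin_T by blast
      then have "cyl k x \<times> cyl k y \<subseteq> ?P"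
        using xy mult_cyl cyl_subset[THEN subsetD] by auto
      then show "\<exists>V W. openin T V \<and> openin T W \<and> x \<in> V \<and> y \<in> W \<and> V \<times> W \<subseteq> ?P"
        using openin_cyl in_cyl xy by (intro exI[of _ "cyl k x"] exI[of _ "cyl k y"]) simp
    qed
  qed auto
  show "continuous_map T T (\<lambda>x. inv x)"
    unfolding continuous_map_def
  proof (intro conjI allI impI)
    fix U assume U: "openin T U"
    show "openin T {x \<in> topspace T. inv x \<in> U}"
      unfolding openin_T
    proof (intro conjI ballI)
      fix x assume x: "x \<in> {x \<in> topspace T. inv x \<in> U}"
      then obtain k where "cyl k (inv x) \<subseteq> U"
        using U openin_T by blast
      then have "cyl k x \<subseteq> {x \<in> topspace T. inv x \<in> U}"
        using x inv_cyl cyl_subset[THEN subsetD] by auto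
      then show "\<exists>k. cyl k x \<subseteq> {x \<in> topspace T. inv x \<in> U}" by blast
    qed auto
  qed auto
qed simp

lemma profinite_group_T: "profinite_group G T"
proof -
  have "compact_space T"
    unfolding T_def compact_space_product_topology by (simp add: finite_C compact_space_discrete_topology)
  moreover have "Hausdorff_space T"
    unfolding T_def Hausdorff_space_product_topology by simp
  ultimately show ?thesis
    using topological_group_T totally_disconnected_product_discrete
    unfolding profinite_group_def T_def by blast
qed

definition \<mu> :: "(nat \<Rightarrow> 'a) measure" where
  "\<mu> = PiM UNIV (\<lambda>i. uniform_count_measure (C i))"

lemma C_nonempty: "C i \<noteq> {}"
  using one_closed by (auto simp: carrier_eq)

lemma product_prob_space_C: "product_prob_space (\<lambda>i. uniform_count_measure (C i))"
  by (intro product_prob_space.intro product_sigma_finite.intro product_prob_space_axioms.intro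
      prob_space_uniform_count_measure prob_space_imp_sigma_finite finite_C C_nonempty)

lemma space_\<mu> [simp]: "space \<mu> = carrier G"
  by (simp add: \<mu>_def space_PiM space_uniform_count_measure carrier_eq PiE_UNIV_domain)

lemma prob_space_\<mu>: "prob_space \<mu>"
  unfolding \<mu>_def
  by (intro prob_space_PiM prob_space_uniform_count_measure finite_C C_nonempty)

lemma countable_cyl: "countable {cyl k x |k x. x \<in> carrier G}"
proof -
  have "cyl k x \<in> (\<Union>k. (\<lambda>f. {y \<in> carrier G. \<forall>i<r k. y i = f i}) ` (Pi\<^sub>E {..<r k} C))" if "x \<in> carrier G" for k x
    using that by (intro UN_I[of k] image_eqI[of _ _ "restrict x {..<r k}"]) (auto simp: cyl_def carrier_eq)
  moreover have "countable (\<Union>k. (\<lambda>f. {y \<in> carrier G. \<forall>i<r k. y i = f i}) ` (Pi\<^sub>E {..<r k} C))"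
    by (intro countable_UN countableI_type countable_image countable_finite finite_PiE finite_C) auto
  ultimately show ?thesis
    by (elim countable_subset[rotated]) blast
qed

lemma cyl_sets: "x \<in> carrier G \<Longrightarrow> cyl k x \<in> sets \<mu>"
proof -
  have "{y \<in> space \<mu>. \<forall>i\<in>{..<r k}. y i \<in> {x i}} \<in> sets \<mu>" if "x \<in> carrier G"
    unfolding \<mu>_def using that
    by (intro sets.sets_Collect_finite_All sets_Collect_single') (auto simp: sets_uniform_count_measure space_uniform_count_measure carrier_eq)
  moreover have "{y \<in> space \<mu>. \<forall>i\<in>{..<r k}. y i \<in> {x i}} = cyl k x"
    by (auto simp: cyl_def)
  ultimately show "x \<in> carrier G \<Longrightarrow> cyl k x \<in> sets \<mu>" by simp
qed

lemma emeasure_cyl: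
  assumes "x \<in> carrier G"
  shows "emeasure \<mu> (cyl k x) = (\<Prod>i<r k. ennreal (1 / card (C i)))"
proof -
  interpret product_prob_space "\<lambda>i. uniform_count_measure (C i)" UNIV
    by (rule product_prob_space_C)
  have "cyl k x = {y \<in> space \<mu>. \<forall>i\<in>{..<r k}. y i \<in> {x i}}"
    by (auto simp: cyl_def)
  also have "emeasure \<mu> \<dots> = (\<Prod>i<r k. emeasure (uniform_count_measure (C i)) {x i})"
    unfolding \<mu>_def using assms by (intro emeasure_PiM_Collect) (auto simp: sets_uniform_count_measure carrier_eq)
  also have "\<dots> = (\<Prod>i<r k. ennreal (1 / card (C i)))"
    using assms by (intro prod.cong refl, subst emeasure_uniform_count_measure) (auto simp: finite_C carrier_eq)
  finally show ?thesis .
qed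

lemma open_sets: "openin T U \<Longrightarrow> U \<in> sets \<mu>"
proof -
  assume U: "openin T U"
  let ?\<C> = "{cyl k x |k x. x \<in> carrier G}"
  have "U = \<Union>{A \<in> ?\<C>. A \<subseteq> U}"
  proof
    show "U \<subseteq> \<Union>{A \<in> ?\<C>. A \<subseteq> U}"
    proof
      fix x assume "x \<in> U"
      then obtain k where "cyl k x \<subseteq> U" "x \<in> carrier G" using U openin_T by blast
      then show "x \<in> \<Union>{A \<in> ?\<C>. A \<subseteq> U}" using in_cyl by blast
    qed
  qed blast
  moreover have "\<Union>{A \<in> ?\<C>. A \<subseteq> U} \<in> sets \<mu>"
    using countable_cyl cyl_sets by (intro sets.countable_Union countable_subset[OF _ countable_cyl]) auto
  ultimately show "U \<in> sets \<mu>" by simp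
qed

lemma sets_\<mu>_cyl: "sets \<mu> = sigma_sets (carrier G) (insert {} {cyl k x |k x. x \<in> carrier G})" (is "_ = sigma_sets _ ?E")
proof
  have E: "?E \<subseteq> Pow (carrier G)" using cyl_subset by blast
  show "sigma_sets (carrier G) ?E \<subseteq> sets \<mu>"
    using sets.sigma_sets_subset[of ?E \<mu>] cyl_sets by auto
  interpret S: sigma_algebra "carrier G" "sigma_sets (carrier G) ?E"
    by (rule sigma_algebra_sigma_sets[OF E])
  have "{f \<in> carrier G. f i \<in> A} \<in> sigma_sets (carrier G) ?E" for i A
  proof -
    obtain k where k: "Suc i \<le> r k" using r_unbounded by blast
    let ?F = "{cyl k x |x. x \<in> carrier G \<and> x i \<in> A}"
    have "{f \<in> carrier G. f i \<in> A} = \<Union>?F"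
    proof
      show "{f \<in> carrier G. f i \<in> A} \<subseteq> \<Union>?F" using in_cyl by blast
      show "\<Union>?F \<subseteq> {f \<in> carrier G. f i \<in> A}" using k by (auto simp: cyl_def)
    qed
    moreover have "countable ?F"
      by (rule countable_subset[OF _ countable_cyl]) blast
    moreover have "?F \<subseteq> sigma_sets (carrier G) ?E"
      by (auto intro: sigma_sets.Basic)
    ultimately show ?thesis
      using S.countable_Union[of ?F] by simp
  qed
  then have "sigma_sets (carrier G) {{f \<in> carrier G. f i \<in> A} |i A. A \<subseteq> C i} \<subseteq> sigma_sets (carrier G) ?E"
    by (intro sigma_sets_mono) blast
  then show "sets \<mu> \<subseteq> sigma_sets (carrier G) ?E"
    by (simp add: \<mu>_def sets_PiM_single space_uniform_count_measure sets_uniform_count_measure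
        carrier_eq PiE_UNIV_domain)
qed

lemma sets_\<mu>: "sets \<mu> = sigma_sets (carrier G) {U. openin T U}"
proof
  show "sigma_sets (carrier G) {U. openin T U} \<subseteq> sets \<mu>"
    using sets.sigma_sets_subset[of "{U. openin T U}" \<mu>] open_sets by auto
  show "sets \<mu> \<subseteq> sigma_sets (carrier G) {U. openin T U}"
    unfolding sets_\<mu>_cyl by (rule sigma_sets_mono') (auto intro: openin_cyl)
qed

lemma l_coset_vimage:
  assumes "g \<in> carrier G" "A \<subseteq> carrier G"
  shows "g <# A = (\<lambda>x. inv g \<otimes> x) -` A \<inter> carrier G"
proof
  show "g <# A \<subseteq> (\<lambda>x. inv g \<otimes> x) -` A \<inter> carrier G"
  proof
    fix x assume "x \<in> g <# A"
    then obtain a where a: "a \<in> A" "x = g \<otimes> a" by (auto simp: l_coset_def)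
    moreover have "a \<in> carrier G" using a(1) assms(2) by blast
    ultimately show "x \<in> (\<lambda>x. inv g \<otimes> x) -` A \<inter> carrier G"
      using assms(1) by (simp flip: m_assoc)
  qed
  show "(\<lambda>x. inv g \<otimes> x) -` A \<inter> carrier G \<subseteq> g <# A"
  proof
    fix x assume "x \<in> (\<lambda>x. inv g \<otimes> x) -` A \<inter> carrier G"
    then have "inv g \<otimes> x \<in> A" "x = g \<otimes> (inv g \<otimes> x)"
      using assms by (auto simp flip: m_assoc)
    then show "x \<in> g <# A" by (auto simp: l_coset_def)
  qed
qed

lemma l_coset_cyl_vimage:
  assumes "g \<in> carrier G" "x \<in> carrier G"
  shows "(\<lambda>x. inv g \<otimes> x) -` cyl k x \<inter> carrier G = cyl k (g \<otimes> x)"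
  using l_coset_vimage[OF assms(1) cyl_subset] l_coset_cyl[OF assms] by simp

lemma translation_measurable:
  assumes g: "g \<in> carrier G"
  shows "(\<lambda>x. inv g \<otimes> x) \<in> measurable \<mu> \<mu>"
proof (rule measurable_sigma_sets[OF sets_\<mu>_cyl])
  show "insert {} {cyl k x |k x. x \<in> carrier G} \<subseteq> Pow (carrier G)" using cyl_subset by blast
  show "(\<lambda>x. inv g \<otimes> x) \<in> space \<mu> \<rightarrow> carrier G" using g by simp
  show "(\<lambda>x. inv g \<otimes> x) -` A \<inter> space \<mu> \<in> sets \<mu>"
    if A: "A \<in> insert {} {cyl k x |k x. x \<in> carrier G}" for A
  proof (cases "A = {}")
    case False
    then obtain k x where "A = cyl k x" and x: "x \<in> carrier G" using A by blast
    then have "(\<lambda>x. inv g \<otimes> x) -` A \<inter> space \<mu> = cyl k (g \<otimes> x)"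
      using l_coset_cyl_vimage[OF g x] by simp
    then show ?thesis using cyl_sets g x by simp
  qed simp
qed

text \<open>Translation permutes the cylinders with the same \<open>k\<close>, whose measure depends only on \<open>k\<close>.\<close>

lemma translation_invariant:
  assumes g: "g \<in> carrier G"
  shows "distr \<mu> \<mu> (\<lambda>x. inv g \<otimes> x) = \<mu>"
proof -
  let ?E = "insert {} {cyl k x |k x. x \<in> carrier G}"
  let ?f = "\<lambda>x. inv g \<otimes> x"
  note meas = translation_measurable[OF g]
  show ?thesis
  proof (rule measure_eqI_generator_eq_countable[where E = ?E and \<Omega> = "carrier G"
        and A = "{cyl k x |k x. x \<in> carrier G}"])
    show "Int_stable ?E"
    proof (rule Int_stableI)
      fix A B assume AB: "A \<in> ?E" "B \<in> ?E"
      have "cyl k x \<inter> cyl l y \<in> ?E" if "x \<in> carrier G" "y \<in> carrier G" for k l x y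
      proof (cases "cyl k x \<inter> cyl l y = {}")
        case False
        then obtain z where z: "z \<in> cyl k x" "z \<in> cyl l y" by blast
        then have "cyl k x = cyl k z" "cyl l y = cyl l z" "z \<in> carrier G"
          using cyl_eq cyl_subset by blast+
        moreover have "cyl k z \<inter> cyl l z = cyl k z \<or> cyl k z \<inter> cyl l z = cyl l z"
          using cyl_antimono[of k l z] cyl_antimono[of l k z] by (cases "r k \<le> r l") auto
        ultimately show ?thesis by auto
      qed auto
      note * = this
      show "A \<inter> B \<in> ?E"
      proof (cases "A = {} \<or> B = {}")
        case False
        with AB obtain k l x y where "A = cyl k x" "x \<in> carrier G" "B = cyl l y" "y \<in> carrier G"
          by blast
        then show ?thesis using * by simp
      qed auto
    qed
    show "?E \<subseteq> Pow (carrier G)" using cyl_subset by blast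
    show "emeasure (distr \<mu> \<mu> ?f) A = emeasure \<mu> A" if A: "A \<in> ?E" for A
    proof (cases "A = {}")
      case False
      then obtain k x where Ak: "A = cyl k x" and x: "x \<in> carrier G" using A by auto
      have "emeasure (distr \<mu> \<mu> ?f) A = emeasure \<mu> (cyl k (g \<otimes> x))"
        using emeasure_distr[OF meas cyl_sets[OF x]] l_coset_cyl_vimage[OF g x] Ak by simp
      also have "\<dots> = emeasure \<mu> A"
        using emeasure_cyl g x Ak by simp
      finally show ?thesis .
    qed simp
    show "sets (distr \<mu> \<mu> ?f) = sigma_sets (carrier G) ?E" "sets \<mu> = sigma_sets (carrier G) ?E"
      by (simp_all add: sets_\<mu>_cyl)
    show "\<Union>{cyl k x |k x. x \<in> carrier G} = carrier G"
      using in_cyl cyl_subset by blast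
    show "countable {cyl k x |k x. x \<in> carrier G}" by (rule countable_cyl)
    interpret prob_space "distr \<mu> \<mu> ?f"
      by (rule prob_space.prob_space_distr[OF prob_space_\<mu> meas])
    show "emeasure (distr \<mu> \<mu> ?f) A \<noteq> \<infinity>" for A
      using emeasure_finite[of A] by simp
  qed auto
qed

lemma normalized_haar_measure_\<mu>: "normalized_haar_measure G T \<mu>"
  unfolding normalized_haar_measure_def
proof (intro conjI ballI)
  interpret prob_space \<mu> by (rule prob_space_\<mu>)
  show "space \<mu> = carrier G" "sets \<mu> = sigma_sets (carrier G) {U. openin T U}"
    using sets_\<mu> by auto
  show "emeasure \<mu> (carrier G) = 1"
    using emeasure_space_1 by simp
  show "emeasure \<mu> (g <# A) = emeasure \<mu> A" if g: "g \<in> carrier G" and A: "A \<in> sets \<mu>" for g A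
  proof -
    have "emeasure \<mu> A = emeasure (distr \<mu> \<mu> (\<lambda>x. inv g \<otimes> x)) A"
      using translation_invariant[OF g] by simp
    also have "\<dots> = emeasure \<mu> ((\<lambda>x. inv g \<otimes> x) -` A \<inter> space \<mu>)"
      by (rule emeasure_distr[OF translation_measurable[OF g] A])
    also have "\<dots> = emeasure \<mu> (g <# A)"
      using l_coset_vimage[OF g] sets.sets_into_space[OF A] by simp
    finally show ?thesis ..
  qed
  show "emeasure \<mu> A = (INF U \<in> {U. openin T U \<and> A \<subseteq> U}. emeasure \<mu> U)" if A: "A \<in> sets \<mu>" for A
  proof (rule emeasure_outer_regular[OF _ _ open_sets A])
    let ?F = "{A. A \<subseteq> space \<mu> \<and> openin T A \<and> closedin T A}"
    show "sets \<mu> = sigma_sets (space \<mu>) ?F"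
    proof
      show "sets \<mu> \<subseteq> sigma_sets (space \<mu>) ?F"
        unfolding sets_\<mu>_cyl space_\<mu> using openin_cyl closedin_cyl cyl_subset[THEN subsetD] by (intro sigma_sets_mono') auto
      show "sigma_sets (space \<mu>) ?F \<subseteq> sets \<mu>"
        by (rule sets.sigma_sets_subset) (auto intro: open_sets)
    qed
  qed auto
qed

end

section \<open>p-elements and virtual prosolvability\<close>

lemma (in group) generate_normal_set_mult_subgroup:
  assumes "N \<lhd> G" "x \<in> carrier G"
  shows "subgroup (generate G {x} <#> N) G" "generate G {x} <#> N = N <#> generate G {x}"
proof -
  have S: "subgroup (generate G {x}) G"
    using assms by (intro generate_is_subgroup) auto
  then interpret second_isomorphism_grp N G "generate G {x}"
    using assms by (intro second_isomorphism_grp.intro second_isomorphism_grp_axioms.intro)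
  show eq: "generate G {x} <#> N = N <#> generate G {x}"
    using commut_normal[OF S assms(1)] .
  show "subgroup (generate G {x} <#> N) G"
    unfolding eq by (rule normal_set_mult_subgroup)
qed

lemma (in group) generate_normal_set_mult_mono:
  assumes N: "N \<lhd> G" and x: "x \<in> carrier G" and y: "y \<in> x <# N"
  shows "generate G {y} <#> N \<subseteq> generate G {x} <#> N"
proof -
  note P = generate_normal_set_mult_subgroup(1)[OF N x]
  have "x \<in> generate G {x}" "\<one> \<in> generate G {x}"
    by (auto intro: generate.incl generate.one)
  moreover from this have "N \<subseteq> generate G {x} <#> N"
    using normal_imp_subgroup[OF N, THEN subgroup.subset] unfolding set_mult_def by force
  ultimately have yP: "y \<in> generate G {x} <#> N"
    using y by (auto simp: l_coset_def set_mult_def)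
  have "generate G {y} \<subseteq> generate G {x} <#> N"
    using generate_subgroup_incl[OF _ P, of "{y}"] yP by simp
  then show ?thesis
    using \<open>N \<subseteq> _\<close> subgroup.m_closed[OF P] by (auto simp: set_mult_def[of G "generate G {y}"])
qed

lemma (in group) generate_normal_set_mult_cong:
  assumes N: "N \<lhd> G" and x: "x \<in> carrier G" and y: "y \<in> x <# N"
  shows "generate G {y} <#> N = generate G {x} <#> N"
proof -
  obtain n where n: "n \<in> N" "y = x \<otimes> n" using y by (auto simp: l_coset_def)
  have nc: "n \<in> carrier G" "inv n \<in> N"
    using n normal_imp_subgroup[OF N] by (auto intro: subgroup.mem_carrier subgroup.m_inv_closed)
  then have "x = y \<otimes> inv n" using n x by (simp add: m_assoc)
  then have "x \<in> y <# N" using nc by (auto simp: l_coset_def)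
  moreover have "y \<in> carrier G" using n nc x by simp
  ultimately show ?thesis
    using generate_normal_set_mult_mono[OF N] x y by blast
qed

text \<open>By the second isomorphism theorem the quotient is an image of the cyclic group generated by \<open>g\<close>.\<close>

lemma (in group) finite_p_group_generate_Mod:
  assumes p: "prime p" and N: "N \<lhd> G" and g: "g \<in> carrier G" and pow: "g [^] (p ^ n :: nat) = \<one>"
  shows "finite_p_group p (G\<lparr>carrier := generate G {g} <#> N\<rparr> Mod N)"
proof -
  let ?S = "generate G {g}" and ?Q = "G\<lparr>carrier := generate G {g} <#> N\<rparr> Mod N"
  have S: "subgroup ?S G"
    using g by (intro generate_is_subgroup) auto
  interpret second_isomorphism_grp N G ?S
    using N S by (intro second_isomorphism_grp.intro second_isomorphism_grp_axioms.intro)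
  interpret GS: group "G\<lparr>carrier := ?S\<rparr>"
    using S by (rule subgroup_imp_group)
  note eq = generate_normal_set_mult_subgroup(2)[OF N g]
  have "ord g dvd p ^ n"
    using pow g by (simp add: pow_eq_id)
  moreover have fin: "ord g \<noteq> 0"
    using calculation p by (metis dvd_0_left_iff not_prime_0 power_eq_0_iff)
  ultimately have card_S: "card ?S dvd p ^ n" and "finite ?S"
    using generate_pow_card[OF g] by (auto intro: card_ge_0_finite)
  have nrm: "(N \<inter> ?S) \<lhd> G\<lparr>carrier := ?S\<rparr>"
    using normal_subgrp_intersection_normal by (simp add: Int_commute)
  have iso: "(G\<lparr>carrier := ?S\<rparr>) Mod (N \<inter> ?S) \<cong> ?Q"
    unfolding eq using normal_intersection_quotient_isom by (auto simp: is_iso_def)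
  have "card (rcosets\<^bsub>G\<lparr>carrier := ?S\<rparr>\<^esub> (N \<inter> ?S)) * card (N \<inter> ?S) = card ?S"
    using GS.lagrange[OF normal_imp_subgroup[OF nrm]] by (simp add: order_def)
  then have "card (carrier ?Q) dvd p ^ n"
    using iso_same_card[OF iso] card_S by (metis dvd_mult_left carrier_FactGroup FactGroup_def partial_object.select_convs(1))
  moreover have "group ?Q"
    unfolding eq using normal_intersection_hom by (simp add: group_hom_def)
  ultimately show ?thesis
    unfolding finite_p_group_def using divides_primepow_nat[OF p]
    by (metis card.infinite dvd_0_left_iff not_prime_0 p power_eq_0_iff)
qed

context coordinate_group
begin

text \<open>
  For a single \<open>N\<close> the condition on \<open>g\<close> depends only on the coset of \<open>g\<close> modulo \<open>N\<close>, by
  \<open>generate_normal_set_mult_cong\<close>; so failing it is an open condition.  Closedness is needed to know that the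
  set is measurable.
\<close>

lemma closedin_p_elements: "closedin T (p_elements p G T)"
proof -
  have "openin T (carrier G - p_elements p G T)"
    unfolding openin_T
  proof (intro conjI ballI)
    fix x assume x: "x \<in> carrier G - p_elements p G T"
    then obtain N where N: "N \<lhd> G" "openin T N"
      and bad: "\<not> finite_p_group p (G\<lparr>carrier := generate G {x} <#> N\<rparr> Mod N)"
      by (auto simp: p_elements_def)
    obtain k where k: "cyl k \<one> \<subseteq> N"
      using open_contains_cyl_one N subgroup.one_closed[OF normal_imp_subgroup] by metis
    have "cyl k x \<subseteq> carrier G - p_elements p G T"
    proof
      fix y assume y: "y \<in> cyl k x"
      have "cyl k x = x <# cyl k \<one>"
        using x l_coset_cyl[of x \<one> k] by simp
      then have "y \<in> x <# N"
        using y k by (auto simp: l_coset_def)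
      then have "generate G {y} <#> N = generate G {x} <#> N"
        using generate_normal_set_mult_cong N x by blast
      then show "y \<in> carrier G - p_elements p G T"
        using bad N y cyl_subset by (auto simp: p_elements_def)
    qed
    then show "\<exists>k. cyl k x \<subseteq> carrier G - p_elements p G T" by blast
  qed auto
  then show ?thesis
    by (auto simp: closedin_def p_elements_def)
qed

text \<open>
  An open subgroup contains some \<open>cyl k \<one>\<close>, hence a copy of \<open>A\<close>, and this copy survives in the quotient by
  the open normal subgroup \<open>cyl l \<one>\<close>.
\<close>

lemma not_virtually_prosolvable:
  assumes A: "group A" "\<not> solvable A"
    and embed: "\<And>k. \<exists>l e. r k \<le> r l \<and> e \<in> hom A G \<and> e ` carrier A \<subseteq> cyl k \<one> \<and>
       (\<forall>a\<in>carrier A. e a \<in> cyl l \<one> \<longrightarrow> a = \<one>\<^bsub>A\<^esub>)"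
  shows "\<not> virtually_prosolvable_group G T"
proof
  assume "virtually_prosolvable_group G T"
  then obtain H where H: "subgroup H G" "openin T H"
    and pro: "prosolvable_group (G\<lparr>carrier := H\<rparr>) (subtopology T H)"
    by (auto simp: virtually_prosolvable_group_def)
  obtain k where k: "cyl k \<one> \<subseteq> H"
    using open_contains_cyl_one H subgroup.one_closed by metis
  obtain l e where le: "r k \<le> r l" "e \<in> hom A G" "e ` carrier A \<subseteq> cyl k \<one>"
    and ker: "\<And>a. a \<in> carrier A \<Longrightarrow> e a \<in> cyl l \<one> \<Longrightarrow> a = \<one>\<^bsub>A\<^esub>"
    using embed[of k] by blast
  let ?H = "G\<lparr>carrier := H\<rparr>" and ?N = "cyl l \<one>"
  have NH: "?N \<subseteq> H" using cyl_antimono[OF le(1)] k by blast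
  have nrm: "?N \<lhd> ?H"
    by (rule normal_restrict_supergroup[OF H(1) cyl_one_normal NH])
  have "openin (subtopology T H) ?N"
    using openin_cyl NH by (auto simp: openin_subtopology)
  with pro nrm have solv: "solvable (?H Mod ?N)"
    by (auto simp: prosolvable_group_def)
  interpret N: normal ?N ?H by (rule nrm)
  have eH: "e \<in> hom A ?H"
    using le k by (auto simp: hom_def)
  interpret h: group_hom A "?H Mod ?N" "\<lambda>a. ?N #>\<^bsub>?H\<^esub> e a"
  proof (intro group_hom.intro group_hom_axioms.intro A(1) N.factorgroup_is_group)
    show "(\<lambda>a. ?N #>\<^bsub>?H\<^esub> e a) \<in> hom A (?H Mod ?N)"
      using Group.hom_compose[OF eH N.r_coset_hom_Mod] by (simp add: comp_def)
  qed
  have "inj_on (\<lambda>a. ?N #>\<^bsub>?H\<^esub> e a) (carrier A)"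
    unfolding h.inj_on_one_iff
  proof (intro allI impI)
    fix a assume a: "a \<in> carrier A" "?N #>\<^bsub>?H\<^esub> e a = \<one>\<^bsub>?H Mod ?N\<^esub>"
    then have "?N #>\<^bsub>?H\<^esub> e a = ?N" by (simp add: FactGroup_def)
    moreover have "e a \<in> carrier ?H" using eH a by (auto simp: hom_def)
    ultimately have "e a \<in> ?N"
      using N.rcos_self[of "e a"] N.subgroup_axioms by metis
    then show "a = \<one>\<^bsub>A\<^esub>" using ker a by blast
  qed
  then have "solvable A"
    using h.inj_hom_imp_solvable solv by blast
  with A show False by blast
qed

end

section \<open>The extension of an infinite power by a cyclic 2-group\<close>

lemma group_transport:
  assumes E: "group E" and dec: "\<And>p. dec (enc p) = p"
  shows "group \<lparr>carrier = enc ` carrier E, mult = (\<lambda>x y. enc (dec x \<otimes>\<^bsub>E\<^esub> dec y)), one = enc \<one>\<^bsub>E\<^esub>\<rparr>"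
proof -
  interpret E: group E by (rule E)
  show ?thesis
  proof (rule groupI, goal_cases)
    case (5 x)
    then obtain p where "x = enc p" "p \<in> carrier E" by auto
    then show ?case by (auto simp: dec intro!: bexI[of _ "inv\<^bsub>E\<^esub> p"])
  qed (auto simp: dec E.m_assoc)
qed

text \<open>
  The hypotheses on \<open>\<tau>\<close> and \<open>u\<close> describe an extension of \<open>A\<close> by a group of order 2 in which the square of
  every element outside \<open>A\<close> has order dividing 4.  The injection \<open>c\<close> only serves to store the component in
  \<open>\<int>/2m\<close> as one more coordinate of type \<open>'a\<close>.
\<close>

locale twisted_power = A: group A for A :: "('a, 'm) monoid_scheme" +
  fixes \<tau> :: "'a \<Rightarrow> 'a" and u :: 'a and m :: nat and c :: "nat \<Rightarrow> 'a"
  assumes finite_A: "finite (carrier A)"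
    and tau_hom: "\<tau> \<in> hom A A" and u_closed: "u \<in> carrier A" and tau_u: "\<tau> u = u"
    and tau_tau: "a \<in> carrier A \<Longrightarrow> \<tau> (\<tau> a) \<otimes>\<^bsub>A\<^esub> u = u \<otimes>\<^bsub>A\<^esub> a"
    and order4: "a \<in> carrier A \<Longrightarrow> (a \<otimes>\<^bsub>A\<^esub> \<tau> a \<otimes>\<^bsub>A\<^esub> u) [^]\<^bsub>A\<^esub> (4::nat) = \<one>\<^bsub>A\<^esub>"
    and m_pos: "m > 0" and inj_c: "inj c"
begin

definition P :: "(nat \<Rightarrow> 'a) monoid" where
  "P = product_group UNIV (\<lambda>_. A)"

lemma carrier_P [simp]: "carrier P = (UNIV \<rightarrow> carrier A)"
  and mult_P [simp]: "x \<otimes>\<^bsub>P\<^esub> y = (\<lambda>i. x i \<otimes>\<^bsub>A\<^esub> y i)"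
  and one_P [simp]: "\<one>\<^bsub>P\<^esub> = (\<lambda>i. \<one>\<^bsub>A\<^esub>)"
  by (simp_all add: P_def PiE_UNIV_domain restrict_UNIV)

lemma group_P: "group P"
  by (simp add: P_def)

text \<open>
  The coordinates are cut into blocks of length \<open>m\<close>.  Inside a block \<open>shift\<close> moves every coordinate one step
  up, and \<open>\<tau>\<close> is applied when the last coordinate wraps around to the first.  Hence each orbit of positions
  meets one twist per turn, and the \<open>m\<close>-th power of \<open>shift\<close> is \<open>\<tau>\<close> in every coordinate.
\<close>

definition shift :: "(nat \<Rightarrow> 'a) \<Rightarrow> nat \<Rightarrow> 'a" where
  "shift b n = (if m dvd n then \<tau> (b (n + m - 1)) else b (n - 1))"

definition U :: "nat \<Rightarrow> 'a" where "U = (\<lambda>_. u)"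

lemma U_apply [simp]: "U n = u"
  by (simp add: U_def)

lemma shift_funpow:
  "i \<le> m \<Longrightarrow> (shift ^^ i) b n = (if n mod m < i then \<tau> (b (n + m - i)) else b (n - i))"
proof (induction i arbitrary: n)
  case (Suc i)
  have i: "i < m" "i \<le> m" using Suc.prems by auto
  show ?case
  proof (cases "m dvd n")
    case True
    then obtain q where q: "n = m * q" by (elim dvdE)
    have "n + m - 1 = m * q + (m - 1)" using q m_pos by simp
    then have "(n + m - 1) mod m = (m - 1) mod m" by (simp only: mod_mult_self4)
    then have "(n + m - 1) mod m = m - 1" using m_pos by simp
    moreover have "\<not> m - 1 < i" using i by simp
    ultimately have "(shift ^^ i) b (n + m - 1) = b (n + m - 1 - i)"
      by (simp only: Suc.IH[OF i(2)] if_False)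
    then have "(shift ^^ Suc i) b n = \<tau> (b (n + m - 1 - i))"
      using True by (simp add: shift_def[of "(shift ^^ i) b" n])
    then show ?thesis using True by simp
  next
    case False
    then have n: "n mod m > 0" by (simp add: mod_greater_zero_iff_not_dvd)
    have "n = m * (n div m) + n mod m" by simp
    then have "n - 1 = m * (n div m) + (n mod m - 1)" using n by linarith
    then have "(n - 1) mod m = (n mod m - 1) mod m" by (metis mod_mult_self4)
    then have "(n - 1) mod m = n mod m - 1"
      using m_pos by (simp add: less_imp_diff_less)
    moreover have "n > 0" using n by (cases n) auto
    ultimately show ?thesis
      using False n i Suc.IH[of "n - 1"] by (auto simp: shift_def)
  qed
qed simp

lemma shift_funpow_m: "(shift ^^ m) b = (\<lambda>n. \<tau> (b n))"
  using m_pos by (auto simp: shift_funpow)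

lemma shift_hom: "shift \<in> hom P P"
  using tau_hom by (intro homI) (auto simp: shift_def hom_def Pi_iff)

lemma cyclic_extension_P: "cyclic_extension P shift U (2 * m)"
proof -
  interpret P: group P by (rule group_P)
  show ?thesis
  proof
    show "shift \<in> hom P P" by (rule shift_hom)
    show "U \<in> carrier P" using u_closed by (simp add: U_def)
    show "shift U = U" using tau_u by (auto simp: U_def shift_def)
    show "(shift ^^ (2 * m)) b \<otimes>\<^bsub>P\<^esub> U = U \<otimes>\<^bsub>P\<^esub> b" if "b \<in> carrier P" for b
      using that tau_tau by (simp add: mult_2 funpow_add shift_funpow_m Pi_iff)
    show "2 * m > 0" using m_pos by simp
  qed
qed

sublocale E: cyclic_extension P shift U "2 * m"
  by (rule cyclic_extension_P)

text \<open>Blocks are preserved; this gives the truncation property of \<open>coordinate_group\<close> with \<open>k\<close> blocks.\<close>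

lemma shift_funpow_local:
  "\<lbrakk>\<forall>n<m * k. b n = b' n; n < m * k\<rbrakk> \<Longrightarrow> (shift ^^ j) b n = (shift ^^ j) b' n"
proof (induction j arbitrary: n)
  case (Suc j)
  have "n + m - 1 < m * k" if dvd: "m dvd n"
  proof -
    obtain q where q: "n = m * q" using dvd by (elim dvdE)
    then have "Suc q \<le> k" using Suc.prems(2) by simp
    then have "m * Suc q \<le> m * k" by (rule mult_le_mono2)
    then show ?thesis using q m_pos by simp
  qed
  then show ?case
    using Suc by (auto simp: shift_def)
qed simp

text \<open>
  The extension lives on pairs; \<open>enc\<close> turns a pair into a single sequence, with the component in \<open>\<int>/2m\<close> at
  position 0, so that the carrier becomes a product of finite sets.
\<close>

definition enc :: "nat \<times> (nat \<Rightarrow> 'a) \<Rightarrow> nat \<Rightarrow> 'a" where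
  "enc p = (\<lambda>i. case i of 0 \<Rightarrow> c (fst p) | Suc n \<Rightarrow> snd p n)"

lemma enc_simps [simp]: "enc p 0 = c (fst p)" "enc p (Suc n) = snd p n"
  by (simp_all add: enc_def)

definition dec :: "(nat \<Rightarrow> 'a) \<Rightarrow> nat \<times> (nat \<Rightarrow> 'a)" where
  "dec x = (inv_into UNIV c (x 0), \<lambda>n. x (Suc n))"

definition C :: "nat \<Rightarrow> 'a set" where
  "C i = (case i of 0 \<Rightarrow> c ` {..<2 * m} | Suc _ \<Rightarrow> carrier A)"

definition G :: "(nat \<Rightarrow> 'a) monoid" where
  "G = \<lparr>carrier = enc ` carrier E.ext, mult = (\<lambda>x y. enc (dec x \<otimes>\<^bsub>E.ext\<^esub> dec y)), one = enc \<one>\<^bsub>E.ext\<^esub>\<rparr>"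

lemma dec_enc [simp]: "dec (enc p) = p"
  using inj_c by (simp add: enc_def dec_def)

lemma carrier_G: "carrier G = enc ` carrier E.ext"
  by (simp add: G_def)

lemma carrier_G_Pi: "carrier G = Pi UNIV C"
proof
  show "carrier G \<subseteq> Pi UNIV C"
    by (auto simp: carrier_G C_def enc_def Pi_iff split: nat.split)
  show "Pi UNIV C \<subseteq> carrier G"
  proof
    fix x assume x: "x \<in> Pi UNIV C"
    have xC: "x i \<in> C i" for i using x by auto
    obtain j where j: "j < 2 * m" "x 0 = c j" using xC[of 0] by (auto simp: C_def)
    have "x = enc (j, \<lambda>n. x (Suc n))"
      by (auto simp: enc_def j fun_eq_iff split: nat.split)
    moreover have "x (Suc n) \<in> carrier A" for n using xC[of "Suc n"] by (simp add: C_def)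
    ultimately show "x \<in> carrier G"
      unfolding carrier_G using j by (intro image_eqI[of _ _ "(j, \<lambda>n. x (Suc n))"]) auto
  qed
qed

lemma mult_enc [simp]: "enc p \<otimes>\<^bsub>G\<^esub> enc q = enc (p \<otimes>\<^bsub>E.ext\<^esub> q)"
  by (simp add: G_def)

lemma one_G: "\<one>\<^bsub>G\<^esub> = enc (0, \<one>\<^bsub>P\<^esub>)"
  by (simp add: G_def)

lemma group_G: "group G"
  unfolding G_def by (rule group_transport[where enc = enc and dec = dec, OF E.group_ext dec_enc])

definition r :: "nat \<Rightarrow> nat" where "r k = Suc (m * k)"

sublocale G: coordinate_group G C r
proof (intro coordinate_group.intro coordinate_group_axioms.intro)
  show "group G" by (rule group_G)
  show "finite (C i)" for i using finite_A by (cases i) (simp_all add: C_def)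
  show "carrier G = Pi UNIV C" by (rule carrier_G_Pi)
  show "\<exists>k. n \<le> r k" for n
    using m_pos by (intro exI[of _ n]) (simp add: r_def le_SucI)
  fix x x' y y' k
  assume car: "x \<in> carrier G" "x' \<in> carrier G" "y \<in> carrier G" "y' \<in> carrier G"
    and agree: "\<forall>i<r k. x i = x' i" "\<forall>i<r k. y i = y' i"
  have *: "\<exists>j a. p = enc (j, a)" if "p \<in> carrier G" for p
    using that carrier_G by auto
  obtain j a j' a' l b l' b' where
    e: "x = enc (j, a)" "x' = enc (j', a')" "y = enc (l, b)" "y' = enc (l', b')"
    using *[OF car(1)] *[OF car(2)] *[OF car(3)] *[OF car(4)] by blast
  have 0: "j = j'" "l = l'"
    using agree[THEN spec[of _ 0]] inj_c by (auto simp: e enc_def r_def dest: injD)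
  have ab: "\<forall>n<m * k. a n = a' n" "\<forall>n<m * k. b n = b' n"
  proof (safe)
    fix n assume "n < m * k"
    then show "a n = a' n" "b n = b' n"
      using agree[THEN spec[of _ "Suc n"]] by (simp_all add: e enc_def r_def)
  qed
  show "\<forall>i<r k. (x \<otimes>\<^bsub>G\<^esub> y) i = (x' \<otimes>\<^bsub>G\<^esub> y') i"
  proof (intro allI impI)
    fix i assume i: "i < r k"
    show "(x \<otimes>\<^bsub>G\<^esub> y) i = (x' \<otimes>\<^bsub>G\<^esub> y') i"
    proof (cases i)
      case (Suc n)
      then have "n < m * k" using i by (simp add: r_def)
      then show ?thesis
        using ab shift_funpow_local[OF ab(2), of n j] by (simp add: e 0 Suc)
    qed (simp add: e 0)
  qed
qed

end

text \<open>In \<open>\<int>/2\<^sup>s\<^sup>+\<^sup>1\<close> every nonzero element has the unique involution among its 2-power multiples.\<close>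

lemma power_of_two_multiple_half:
  "0 < j \<Longrightarrow> j < 2 ^ Suc s \<Longrightarrow> \<exists>t. (j * 2 ^ t) mod 2 ^ Suc s = (2 ^ s :: nat)"
proof (induction s arbitrary: j)
  case 0
  then show ?case by (intro exI[of _ 0]) auto
next
  case (Suc s)
  show ?case
  proof (cases "even j")
    case True
    then obtain i where i: "j = 2 * i" by (elim evenE)
    then obtain t where "(i * 2 ^ t) mod 2 ^ Suc s = 2 ^ s"
      using Suc.IH[of i] Suc.prems by auto
    then have "(j * 2 ^ t) mod 2 ^ Suc (Suc s) = 2 ^ Suc s"
      unfolding i power_Suc[of 2 "Suc s"] mult.assoc mult_mod_right[symmetric] by simp
    then show ?thesis by blast
  next
    case False
    have "(j * 2 ^ Suc s) mod 2 ^ Suc (Suc s) = 2 ^ Suc s * (j mod 2)"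
      using mult_mod_right[of "2 ^ Suc s" j 2] by (simp only: power_Suc2[of 2 "Suc s"] mult.commute[of j])
    then show ?thesis
      using False by (intro exI[of _ "Suc s"]) (simp add: odd_iff_mod_2_eq_one)
  qed
qed

context twisted_power
begin

lemma pow_enc: "p \<in> carrier E.ext \<Longrightarrow> enc p [^]\<^bsub>G\<^esub> (n::nat) = enc (p [^]\<^bsub>E.ext\<^esub> n)"
  by (induction n) (simp_all add: one_G del: one_P)

lemma pow_ext_zero: "w \<in> carrier P \<Longrightarrow> (0, w) [^]\<^bsub>E.ext\<^esub> (n::nat) = (0, \<lambda>i. w i [^]\<^bsub>A\<^esub> n)"
  by (induction n) (auto simp: Pi_iff)

text \<open>Over the involution of \<open>\<int>/2m\<close> the extension is the given extension of \<open>A\<close> by order 2 in each coordinate.\<close>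

lemma square_middle:
  assumes "a \<in> carrier P"
  shows "((m, a) \<otimes>\<^bsub>E.ext\<^esub> (m, a)) [^]\<^bsub>E.ext\<^esub> (4::nat) = \<one>\<^bsub>E.ext\<^esub>"
proof -
  have a: "a i \<in> carrier A" for i using assms by auto
  have "(m, a) \<otimes>\<^bsub>E.ext\<^esub> (m, a) = (0, \<lambda>i. a i \<otimes>\<^bsub>A\<^esub> \<tau> (a i) \<otimes>\<^bsub>A\<^esub> u)"
    using m_pos u_closed by (simp add: shift_funpow_m mult_2[symmetric])
  moreover have "(\<lambda>i. a i \<otimes>\<^bsub>A\<^esub> \<tau> (a i) \<otimes>\<^bsub>A\<^esub> u) \<in> carrier P"
    using a u_closed tau_hom by (auto simp: hom_def)
  ultimately show ?thesis
    using a by (simp add: pow_ext_zero order4)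
qed

lemma nontrivial_coset_2_power_order:
  assumes m: "m = 2 ^ s" and x: "x \<in> carrier G" "x 0 \<noteq> c 0"
  shows "\<exists>n. x [^]\<^bsub>G\<^esub> (2 ^ n :: nat) = \<one>\<^bsub>G\<^esub>"
proof -
  interpret ext: group E.ext by (rule E.group_ext)
  obtain p where p: "p \<in> carrier E.ext" "x = enc p" using x by (auto simp only: carrier_G)
  have j: "0 < fst p" "fst p < 2 ^ Suc s"
  proof -
    have "fst p < 2 * m" using p(1) by auto
    then show "fst p < 2 ^ Suc s" using m by simp
    show "0 < fst p" using p(2) x(2) by (auto simp: enc_def intro: gr0I)
  qed
  obtain t where t: "(fst p * 2 ^ t) mod 2 ^ Suc s = 2 ^ s"
    using power_of_two_multiple_half[OF j] by blast
  define y where "y = p [^]\<^bsub>E.ext\<^esub> (2 ^ t :: nat)"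
  have y: "y \<in> carrier E.ext" unfolding y_def using p by (intro ext.nat_pow_closed)
  moreover have "fst y = m"
    unfolding y_def E.fst_pow_ext[OF p(1)] using t m by simp
  ultimately obtain a where "y = (m, a)" "a \<in> carrier P" by (cases y) auto
  then have "(y \<otimes>\<^bsub>E.ext\<^esub> y) [^]\<^bsub>E.ext\<^esub> (4::nat) = \<one>\<^bsub>E.ext\<^esub>"
    using square_middle by simp
  moreover have "y \<otimes>\<^bsub>E.ext\<^esub> y = y [^]\<^bsub>E.ext\<^esub> Suc (Suc 0)"
    using y by (simp del: E.carrier_ext E.one_ext)
  ultimately have "y [^]\<^bsub>E.ext\<^esub> (Suc (Suc 0) * 4) = \<one>\<^bsub>E.ext\<^esub>"
    using ext.nat_pow_pow[OF y, of "Suc (Suc 0)" 4] by (simp only:)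
  then have "p [^]\<^bsub>E.ext\<^esub> (2 ^ t * (Suc (Suc 0) * 4)) = \<one>\<^bsub>E.ext\<^esub>"
    using ext.nat_pow_pow[OF p(1), of "2 ^ t" "Suc (Suc 0) * 4"] unfolding y_def by (simp only:)
  moreover have "2 ^ t * (Suc (Suc 0) * 4) = (2 ^ (t + 3) :: nat)"
    by (simp add: power_add)
  ultimately have "x [^]\<^bsub>G\<^esub> (2 ^ (t + 3) :: nat) = \<one>\<^bsub>G\<^esub>"
    using p by (simp add: pow_enc one_G del: one_P E.carrier_ext)
  then show ?thesis by blast
qed

text \<open>
  Everything outside the kernel of the map to \<open>\<int>/2m\<close> is a 2-element, and this kernel has index
  \<open>2m = 2\<^sup>s\<^sup>+\<^sup>1\<close>.
\<close>

lemma prob_2_elements: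
  assumes m: "m = 2 ^ s"
  shows "prob_p_elements 2 G G.T G.\<mu> \<ge> 1 - 1 / 2 ^ Suc s"
proof -
  interpret prob_space G.\<mu> by (rule G.prob_space_\<mu>)
  let ?N = "G.cyl 0 \<one>\<^bsub>G\<^esub>"
  have N: "?N = {x \<in> carrier G. x 0 = c 0}"
    by (auto simp: G.cyl_def r_def one_G enc_def)
  have "carrier G - ?N \<subseteq> p_elements 2 G G.T"
  proof
    fix x assume "x \<in> carrier G - ?N"
    then have x: "x \<in> carrier G" "x 0 \<noteq> c 0" by (auto simp: N)
    then show "x \<in> p_elements 2 G G.T"
      unfolding p_elements_def
      using nontrivial_coset_2_power_order[OF m x] G.finite_p_group_generate_Mod[OF two_is_prime_nat] by auto
  qed
  moreover have "p_elements 2 G G.T \<in> sets G.\<mu>"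
  proof -
    have "openin G.T (carrier G - p_elements 2 G G.T)"
      using G.closedin_p_elements by (simp add: closedin_def)
    then have "space G.\<mu> - (carrier G - p_elements 2 G G.T) \<in> sets G.\<mu>"
      by (intro sets.compl_sets G.open_sets)
    moreover have "space G.\<mu> - (carrier G - p_elements 2 G G.T) = p_elements 2 G G.T"
      by (auto simp: p_elements_def)
    ultimately show ?thesis by simp
  qed
  ultimately have "measure G.\<mu> (carrier G - ?N) \<le> prob_p_elements 2 G G.T G.\<mu>"
    unfolding prob_p_elements_def by (intro finite_measure_mono)
  moreover have "measure G.\<mu> (carrier G - ?N) = 1 - measure G.\<mu> ?N"
    using prob_compl[of ?N] G.cyl_sets[OF G.one_closed] by simp
  moreover have "measure G.\<mu> ?N = 1 / 2 ^ Suc s"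
  proof -
    have "card (C 0) = 2 ^ Suc s"
    proof -
      have "card (C 0) = 2 * m" using inj_c by (simp add: C_def card_image inj_on_subset)
      then show ?thesis using m by simp
    qed
    then have "emeasure G.\<mu> ?N = ennreal (1 / 2 ^ Suc s)"
      using G.emeasure_cyl[OF G.one_closed, of 0] by (simp add: r_def)
    then show ?thesis by (simp add: measure_def)
  qed
  ultimately show ?thesis by simp
qed

text \<open>The copy of \<open>A\<close> in the first coordinate of block \<open>k\<close> is trivial on all earlier blocks.\<close>

lemma not_virtually_prosolvable_G:
  assumes "\<not> solvable A"
  shows "\<not> virtually_prosolvable_group G G.T"
proof (rule G.not_virtually_prosolvable[OF A.group_axioms assms])
  fix k
  define e where "e a = enc (0, \<lambda>n. if n = m * k then a else \<one>\<^bsub>A\<^esub>)" for a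
  have "e \<in> hom A G"
  proof (rule homI)
    show "e a \<in> carrier G" if "a \<in> carrier A" for a
      unfolding e_def carrier_G using that m_pos by (intro imageI) auto
    show "e (a \<otimes>\<^bsub>A\<^esub> b) = e a \<otimes>\<^bsub>G\<^esub> e b" if "a \<in> carrier A" "b \<in> carrier A" for a b
      unfolding e_def mult_enc using that by (intro arg_cong[of _ _ enc]) (auto simp: fun_eq_iff)
  qed
  moreover have "e ` carrier A \<subseteq> G.cyl k \<one>\<^bsub>G\<^esub>"
    using hom_in_carrier[OF \<open>e \<in> hom A G\<close>] by (auto simp: G.cyl_def r_def e_def one_G enc_def split: nat.split)
  moreover have "a = \<one>\<^bsub>A\<^esub>" if "e a \<in> G.cyl (Suc k) \<one>\<^bsub>G\<^esub>" for a
  proof -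
    have "Suc (m * k) < r (Suc k)" using m_pos by (simp add: r_def)
    then have "e a (Suc (m * k)) = \<one>\<^bsub>G\<^esub> (Suc (m * k))"
      using that by (simp add: G.cyl_def)
    then show ?thesis by (simp add: e_def enc_def one_G)
  qed
  moreover have "r k \<le> r (Suc k)" by (simp add: r_def)
  ultimately show "\<exists>l e. r k \<le> r l \<and> e \<in> hom A G \<and> e ` carrier A \<subseteq> G.cyl k \<one>\<^bsub>G\<^esub> \<and>
       (\<forall>a\<in>carrier A. e a \<in> G.cyl l \<one>\<^bsub>G\<^esub> \<longrightarrow> a = \<one>\<^bsub>A\<^esub>)"
    by blast
qed

lemma base_isomorphic_power:
  "topologically_isomorphic (G\<lparr>carrier := G.cyl 0 \<one>\<^bsub>G\<^esub>\<rparr>) (subtopology G.T (G.cyl 0 \<one>\<^bsub>G\<^esub>))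
     (product_group (UNIV :: nat set) (\<lambda>_. A))
     (product_topology (\<lambda>_. discrete_topology (carrier A)) UNIV)"
proof -
  let ?N = "G.cyl 0 \<one>\<^bsub>G\<^esub>" and ?Y = "product_topology (\<lambda>_::nat. discrete_topology (carrier A)) UNIV"
  let ?f = "\<lambda>(x :: nat \<Rightarrow> 'a) n. x (Suc n)" and ?g = "\<lambda>b. enc (0, b)"
  have N: "?N = ?g ` carrier P"
  proof
    show "?g ` carrier P \<subseteq> ?N"
      using m_pos by (auto simp: G.cyl_def r_def one_G enc_def carrier_G)
    show "?N \<subseteq> ?g ` carrier P"
      using inj_c by (auto simp: G.cyl_def r_def one_G carrier_G) (auto simp: enc_def dest: injD)
  qed
  have fg: "?f (?g b) = b" for b by (simp add: enc_def)
  have "?f \<in> iso (G\<lparr>carrier := ?N\<rparr>) P"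
  proof (rule isoI)
    show "?f \<in> hom (G\<lparr>carrier := ?N\<rparr>) P"
      by (rule homI) (auto simp: N Pi_iff)
    show "bij_betw ?f (carrier (G\<lparr>carrier := ?N\<rparr>)) (carrier P)"
      by (rule bij_betwI[of _ _ _ ?g]) (auto simp: N fg)
  qed
  moreover have "homeomorphic_map (subtopology G.T ?N) ?Y ?f"
  proof (rule homeomorphic_maps_imp_map)
    show "homeomorphic_maps (subtopology G.T ?N) ?Y ?f ?g"
      unfolding homeomorphic_maps_def
    proof (intro conjI ballI)
      show "continuous_map (subtopology G.T ?N) ?Y ?f"
        unfolding continuous_map_componentwise_UNIV
      proof
        fix n
        have "continuous_map G.T (discrete_topology (C (Suc n))) (\<lambda>x. x (Suc n))"
          unfolding G.T_def by (rule continuous_map_product_projection) simp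
        then show "continuous_map (subtopology G.T ?N) (discrete_topology (carrier A)) (\<lambda>x. x (Suc n))"
          by (auto simp: C_def intro: continuous_map_from_subtopology)
      qed
      have "continuous_map ?Y (discrete_topology (C i)) (\<lambda>b. ?g b i)" for i
      proof (cases i)
        case 0
        then show ?thesis using m_pos by (auto simp: enc_def C_def)
      next
        case (Suc n)
        have "continuous_map ?Y (discrete_topology (carrier A)) (\<lambda>x. x n)"
          by (rule continuous_map_product_projection) simp
        then show ?thesis by (simp add: enc_def C_def Suc)
      qed
      then have "continuous_map ?Y G.T ?g"
        unfolding G.T_def continuous_map_componentwise_UNIV by blast
      then show "continuous_map ?Y (subtopology G.T ?N) ?g"
        by (auto simp: continuous_map_in_subtopology N)
      show "?g (?f x) = x" if "x \<in> topspace (subtopology G.T ?N)" for x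
        using that by (auto simp: N fg)
      show "?f (?g y) = y" for y by (rule fg)
    qed
  qed
  ultimately show ?thesis
    unfolding topologically_isomorphic_def P_def by blast
qed

end

section \<open>Groups with many 2-elements\<close>

theorem mainTheorem6:
  fixes c :: real
  assumes "0 < c" and "c < 1"
  shows "\<exists>(G :: (nat \<Rightarrow> nat \<Rightarrow> nat) monoid) T \<mu>.
    profinite_group G T \<and>
    normalized_haar_measure G T \<mu> \<and>
    (\<exists>N (I :: nat set). N \<lhd> G \<and> closedin T N \<and> infinite I \<and>
       topologically_isomorphic
         (G\<lparr>carrier := N\<rparr>) (subtopology T N)
         (product_group I (\<lambda>_. alt_group 6))
         (product_topology (\<lambda>_. discrete_topology (carrier (alt_group 6))) I)) \<and>
    \<not> virtually_prosolvable_group G T \<and>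
    prob_p_elements 2 G T \<mu> \<ge> c"
proof -
  obtain \<tau> u where \<tau>: "\<tau> \<in> hom (alt_group 6) (alt_group 6)" "u \<in> carrier (alt_group 6)" "\<tau> u = u"
    and \<tau>\<tau>: "\<And>a. a \<in> carrier (alt_group 6) \<Longrightarrow> \<tau> (\<tau> a) \<circ> u = u \<circ> a"
    and ord: "\<And>a. a \<in> carrier (alt_group 6) \<Longrightarrow> ((a \<circ> \<tau> a \<circ> u) ^^ 4) = id"
    using alt_group_6_twist by metis
  have pow: "x [^]\<^bsub>alt_group 6\<^esub> (n::nat) = x ^^ n" for x n
  proof (induction n)
    case (Suc n)
    then show ?case
      by (simp add: nat_pow_def alt_group_mult funpow_Suc_right del: funpow.simps)
  qed (simp add: nat_pow_def alt_group_one id_def)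
  have "finite (carrier (alt_group 6))"
    by (rule finite_subset[OF _ finite_permutations[of "{1..6}"]]) (auto simp: alt_group_carrier)
  obtain s where s: "(1 / 2) ^ s < 1 - c"
    using real_arch_pow_inv[of "1 - c" "1 / 2"] assms by auto
  interpret twisted_power "alt_group 6" \<tau> u "2 ^ s" "\<lambda>j _. j"
  proof (intro twisted_power.intro twisted_power_axioms.intro alt_group_is_group \<tau>)
    show "finite (carrier (alt_group 6))" by fact
    show "inj (\<lambda>j (_::nat). j :: nat)" by (auto simp: inj_def fun_eq_iff)
  qed (simp_all add: \<tau>\<tau> ord pow alt_group_mult alt_group_one)
  have "(1 / 2 :: real) ^ Suc s \<le> (1 / 2) ^ s"
    by (rule power_decreasing) simp_all
  with s have "(1 / 2) ^ Suc s \<le> 1 - c"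
    by linarith
  then have "c \<le> 1 - 1 / 2 ^ Suc s"
    by (simp add: power_one_over)
  also have "\<dots> \<le> prob_p_elements 2 G G.T G.\<mu>"
    by (rule prob_2_elements) simp
  finally have "c \<le> prob_p_elements 2 G G.T G.\<mu>" .
  moreover have "\<not> virtually_prosolvable_group G G.T"
    by (rule not_virtually_prosolvable_G) (simp add: alt_group_is_unsolvable)
  ultimately show ?thesis
    using G.profinite_group_T G.normalized_haar_measure_\<mu> G.cyl_one_normal G.closedin_cyl
      base_isomorphic_power infinite_UNIV_nat
    by (intro exI[of _ G] exI[of _ G.T] exI[of _ G.\<mu>] conjI exI[of _ "G.cyl 0 \<one>\<^bsub>G\<^esub>"]
        exI[of _ "UNIV :: nat set"])
qed

end
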